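(* There exist linear operators $\mathcal{D},\mathcal{L}:\mathbb{C}[u,\mathbf{v}]\to\mathbb{C}[u,\mathbf{v}]$ such that, setting $\mathcal{D}_N=\mathcal{D}-\frac{1}{N^2}\mathcal{L}$, we have $\Delta_N(p_N)=(\mathcal{D}_Np)_N$ for all $N\ge1$ and all $p\in\mathbb{C}[u,\mathbf{v}]$. Moreover $\mathcal{D}$ is the unique linear operator on $\mathbb{C}[u,\mathbf{v}]$ satisfying: (1) $\mathcal{D}(u^k)=-ku^k-2\sum_{m=1}^{k-1}mu^mv_{k-m}$ for all $k\ge1$; (2) $\mathcal{D}(v_k)=-kv_k-2\sum_{m=1}^{k-1}mv_mv_{k-m}$ for all $k\ge1$; (3) $\mathcal{D}(pq)=\mathcal{D}(p)q+p\mathcal{D}(q)$ for all $p,q\in\mathbb{C}[u,\mathbf{v}]$ such that $p$ or $q$ is scalar.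
   Context: $\mathbb{C}[u,\mathbf{v}]$ is the polynomial algebra over $\mathbb{C}$ in one indeterminate $u$ and infinitely many indeterminates $\mathbf{v}=(v_1,v_2,\dots)$ (each element involves finitely many of them); $p$ is scalar if it does not depend on $u$. For $p\in\mathbb{C}[u,\mathbf{v}]$ and $N\ge1$, $p_N:U(N)\to M_N(\mathbb{C})$ is $p_N(U)=p(U,\mathrm{tr}(U),\mathrm{tr}(U^2),\dots)$, i.e. substitute $u=U$, $v_j=\mathrm{tr}(U^j)I$, where $\mathrm{tr}=\frac1N\mathrm{Trace}$. $\Delta_N=\sum_j\tilde X_j^2$ for an orthonormal basis of $u(N)$ with respect to $\langle X,Y\rangle_N=N\,\mathrm{Re}\,\mathrm{Trace}(X^*Y)$, $(\tilde Xf)(U)=\frac{d}{ds}f(Ue^{sX})|_{s=0}$, acting entrywise. *)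

theory Defs
  imports "HOL-Analysis.Analysis" "HOL-Library.Poly_Mapping" "Jordan_Normal_Form.Matrix"
begin

(* C[u, v_1, v_2, ...]: a monomial is a finitely supported exponent map nat =>0 nat,
   where index 0 is the exponent of u and index j >= 1 is the exponent of v_j. *)
type_synonym cpoly = "(nat \<Rightarrow>\<^sub>0 nat) \<Rightarrow>\<^sub>0 complex"

definition var_u :: cpoly where
  "var_u = Poly_Mapping.single (Poly_Mapping.single 0 1) 1"

definition var_v :: "nat \<Rightarrow> cpoly" where
  "var_v k = Poly_Mapping.single (Poly_Mapping.single k 1) 1"

definition csmult :: "complex \<Rightarrow> cpoly \<Rightarrow> cpoly" where
  "csmult c p = Poly_Mapping.map (\<lambda>x. c * x) p"

definition is_scalar :: "cpoly \<Rightarrow> bool" where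
  "is_scalar p \<longleftrightarrow> (\<forall>m \<in> Poly_Mapping.keys p. Poly_Mapping.lookup m 0 = 0)"

definition is_linear_op :: "(cpoly \<Rightarrow> cpoly) \<Rightarrow> bool" where
  "is_linear_op T \<longleftrightarrow> (\<forall>p q. T (p + q) = T p + T q) \<and> (\<forall>c p. T (csmult c p) = csmult c (T p))"

definition ntr :: "nat \<Rightarrow> complex mat \<Rightarrow> complex" where
  "ntr N A = (\<Sum>i<N. A $$ (i, i)) / of_nat N"

definition adj :: "nat \<Rightarrow> complex mat \<Rightarrow> complex mat" where
  "adj N A = mat N N (\<lambda>(i, j). cnj (A $$ (j, i)))"

definition unitary_mat :: "nat \<Rightarrow> complex mat \<Rightarrow> bool" where
  "unitary_mat N U \<longleftrightarrow> U \<in> carrier_mat N N \<and> U * adj N U = 1\<^sub>m N"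

definition lie_u :: "nat \<Rightarrow> complex mat set" where
  "lie_u N = {X. X \<in> carrier_mat N N \<and> adj N X = - X}"

definition ip_N :: "nat \<Rightarrow> complex mat \<Rightarrow> complex mat \<Rightarrow> real" where
  "ip_N N X Y = real N * Re (\<Sum>i<N. (adj N X * Y) $$ (i, i))"

definition orthonormal_basis_u :: "nat \<Rightarrow> complex mat set \<Rightarrow> bool" where
  "orthonormal_basis_u N B \<longleftrightarrow> finite B \<and> B \<subseteq> lie_u N
     \<and> (\<forall>X\<in>B. \<forall>Y\<in>B. ip_N N X Y = (if X = Y then 1 else 0))
     \<and> (\<forall>X\<in>lie_u N. \<exists>c :: complex mat \<Rightarrow> real.
            (\<forall>i<N. \<forall>j<N. X $$ (i, j) = (\<Sum>Y\<in>B. complex_of_real (c Y) * Y $$ (i, j))))"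

definition mexp :: "nat \<Rightarrow> complex mat \<Rightarrow> complex mat" where
  "mexp N X = mat N N (\<lambda>(i, j). suminf (\<lambda>k. (X ^\<^sub>m k) $$ (i, j) / of_nat (fact k)))"

definition lvf :: "nat \<Rightarrow> complex mat \<Rightarrow> (complex mat \<Rightarrow> complex) \<Rightarrow> complex mat \<Rightarrow> complex" where
  "lvf N X f U = vector_derivative (\<lambda>s::real. f (U * mexp N (complex_of_real s \<cdot>\<^sub>m X))) (at 0)"

(* p_N(U): substitute u = U, v_j = tr(U^j) I *)
definition eval_N :: "nat \<Rightarrow> cpoly \<Rightarrow> complex mat \<Rightarrow> complex mat" where
  "eval_N N p U = mat N N (\<lambda>(i, j). \<Sum>m\<in>Poly_Mapping.keys p.
      Poly_Mapping.lookup p m * (\<Prod>k\<in>Poly_Mapping.keys m - {0}. ntr N (U ^\<^sub>m k) ^ Poly_Mapping.lookup m k)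
        * (U ^\<^sub>m Poly_Mapping.lookup m 0) $$ (i, j))"

definition laplacian_N :: "nat \<Rightarrow> complex mat set \<Rightarrow> (complex mat \<Rightarrow> complex mat) \<Rightarrow> complex mat \<Rightarrow> complex mat" where
  "laplacian_N N B F U = mat N N (\<lambda>(i, j). \<Sum>X\<in>B. lvf N X (lvf N X (\<lambda>V. F V $$ (i, j))) U)"

definition D_conditions :: "(cpoly \<Rightarrow> cpoly) \<Rightarrow> bool" where
  "D_conditions D \<longleftrightarrow>
     (\<forall>k\<ge>1. D (var_u ^ k) = - (of_nat k * var_u ^ k)
          - 2 * (\<Sum>m\<in>{1..<k}. of_nat m * var_u ^ m * var_v (k - m)))
   \<and> (\<forall>k\<ge>1. D (var_v k) = - (of_nat k * var_v k)
          - 2 * (\<Sum>m\<in>{1..<k}. of_nat m * var_v m * var_v (k - m)))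
   \<and> (\<forall>p q. is_scalar p \<or> is_scalar q \<longrightarrow> D (p * q) = D p * q + p * D q)"

end

theory Submission
  imports Defs
begin

text \<open>
  An orthonormal basis of the skew-Hermitian matrices satisfies the completeness relation
  \<open>\<Sum>\<^sub>X X\<^sub>a\<^sub>b X\<^sub>c\<^sub>d = - \<delta>\<^sub>a\<^sub>d \<delta>\<^sub>b\<^sub>c / N\<close>. It determines the carre du champ \<open>\<Sum>\<^sub>X (X f) (X g)\<close> of matrix
  entries of powers: contracting two entries produces a trace of order one, while contracting
  anything with \<open>tr (U\<^sup>l)\<close> only produces a term of order \<open>1/N\<^sup>2\<close>. The Laplacian of a product is
  \<open>\<Delta>(f g) = \<Delta>f g + f \<Delta>g + 2 \<Gamma>(f, g)\<close>, so by induction on a monomial, multiplying by one \<open>v\<^sub>k\<close> at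
  a time, the order-one part obeys exactly the product rule that characterises \<open>D\<close>, and the
  remaining \<open>1/N\<^sup>2\<close> part is again the evaluation of a polynomial that does not depend on \<open>N\<close>.
\<close>

section \<open>Matrix powers and the matrix exponential\<close>

text \<open>Powers of N are counted by loops. Contracting two letters of the same word cuts off a
  closed loop, an unnormalised trace, and the 1/N of the completeness relation turns it into
  \<open>ntr\<close>. If one letter lies inside tr (U^l), the contraction merges the two words
  instead: no loop appears, and the normalisation of that trace supplies the second 1/N. The
  obstacle is that multiplication by u obeys no such product rule: passing from U^k to U^(k+1)
  creates cross terms of order one. So U^k is treated as a block, by induction on k at the level of
  matrix entries, and only the factors v_k are split off algebraically. Uniformity in N is obtained
  by quantifying the correction polynomial before N, the basis, the matrix and the indices. L needs
  no closed formula: a correction is chosen for each monomial and extended linearly.\<close>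

lemma pow_mat_add_exponents:
  fixes U :: "'a::semiring_1 mat"
  assumes "U \<in> carrier_mat N N"
  shows "U ^\<^sub>m (a + b) = U ^\<^sub>m a * U ^\<^sub>m b"
proof (induction b)
  case 0
  then show ?case using assms pow_carrier_mat[OF assms, of a] by simp
next
  case (Suc b)
  then show ?case
    using assoc_mult_mat[OF pow_carrier_mat[OF assms] pow_carrier_mat[OF assms] assms] by simp
qed

lemma pow_mat_entry_add:
  fixes U :: "'a::semiring_1 mat"
  assumes U: "U \<in> carrier_mat N N" and "i < N" "j < N"
  shows "(\<Sum>r<N. (U ^\<^sub>m a) $$ (i, r) * (U ^\<^sub>m b) $$ (r, j)) = (U ^\<^sub>m (a + b)) $$ (i, j)"
  using assms pow_carrier_mat[OF U, of a] pow_carrier_mat[OF U, of b]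
  by (simp add: pow_mat_add_exponents[OF U] scalar_prod_def atLeast0LessThan)

lemma smult_pow_mat:
  fixes X :: "'a::comm_semiring_1 mat"
  assumes "X \<in> carrier_mat N N"
  shows "(c \<cdot>\<^sub>m X) ^\<^sub>m k = c ^ k \<cdot>\<^sub>m (X ^\<^sub>m k)"
proof (induction k)
  case 0
  then show ?case using assms by (auto intro!: eq_matI)
next
  case (Suc k)
  then show ?case
    using assms pow_carrier_mat[OF assms, of k]
    by (auto intro!: eq_matI simp: mult_smult_distrib mult_ac)
qed

text \<open>The sum of the norms of all entries absorbs one factor X at a time, because an entry is
  bounded by the sum over its row. This crude geometric bound makes the entries of the exponential
  series comparable with a scalar exponential series.\<close>

lemma norm_pow_mat_entry_le:
  fixes X :: "complex mat"
  assumes X: "X \<in> carrier_mat N N" and "i < N" "j < N"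
  shows "norm ((X ^\<^sub>m k) $$ (i, j)) \<le> (\<Sum>a<N. \<Sum>b<N. norm (X $$ (a, b))) ^ k"
  using assms(2,3)
proof (induction k arbitrary: i j)
  case 0
  then show ?case using X by simp
next
  case (Suc k)
  let ?M = "\<Sum>a<N. \<Sum>b<N. norm (X $$ (a, b))"
  have "(X ^\<^sub>m Suc k) $$ (i, j) = (\<Sum>r<N. (X ^\<^sub>m k) $$ (i, r) * X $$ (r, j))"
    using pow_mat_entry_add[OF X Suc.prems, of k 1] X by simp
  also have "norm \<dots> \<le> (\<Sum>r<N. norm ((X ^\<^sub>m k) $$ (i, r)) * norm (X $$ (r, j)))"
    by (rule order_trans[OF norm_sum]) (simp add: norm_mult)
  also have "\<dots> \<le> (\<Sum>r<N. ?M ^ k * (\<Sum>b<N. norm (X $$ (r, b))))"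
  proof (intro sum_mono mult_mono)
    fix r assume "r \<in> {..<N}"
    then show "norm ((X ^\<^sub>m k) $$ (i, r)) \<le> ?M ^ k" using Suc by simp
    show "norm (X $$ (r, j)) \<le> (\<Sum>b<N. norm (X $$ (r, b)))"
      using Suc.prems by (intro member_le_sum) auto
  qed (auto intro!: sum_nonneg zero_le_power)
  also have "\<dots> = ?M ^ Suc k"
    by (simp add: sum_distrib_left[symmetric])
  finally show ?case .
qed

lemma mexp_carrier: "mexp N X \<in> carrier_mat N N"
  by (simp add: mexp_def)

text \<open>Each entry is an everywhere convergent complex power series in s, so it may be
  differentiated termwise and then restricted to real s.\<close>

lemma mexp_entry_has_vector_derivative:
  assumes X: "X \<in> carrier_mat N N" and ij: "i < N" "j < N"
  shows "((\<lambda>s::real. mexp N (complex_of_real s \<cdot>\<^sub>m X) $$ (i, j)) has_vector_derivative X $$ (i, j)) (at 0)"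
proof -
  define c where "c k = (X ^\<^sub>m k) $$ (i, j) / of_nat (fact k)" for k
  let ?M = "\<Sum>a<N. \<Sum>b<N. norm (X $$ (a, b))"
  have "summable (\<lambda>k. c k * y ^ k)" for y
  proof (rule summable_comparison_test')
    show "summable (\<lambda>k. inverse (fact k) * (?M * norm y) ^ k)"
      by (rule summable_exp)
    fix k :: nat
    have "norm (c k * y ^ k) = norm ((X ^\<^sub>m k) $$ (i, j)) * (inverse (fact k) * norm y ^ k)"
      by (simp add: c_def norm_mult norm_divide norm_power field_simps)
    also have "\<dots> \<le> ?M ^ k * (inverse (fact k) * norm y ^ k)"
      by (intro mult_right_mono norm_pow_mat_entry_le assms) auto
    finally show "norm (c k * y ^ k) \<le> inverse (fact k) * (?M * norm y) ^ k"
      by (simp add: power_mult_distrib mult_ac)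
  qed
  then have "((\<lambda>x. suminf (\<lambda>k. c k * x ^ k)) has_field_derivative (suminf (\<lambda>k. diffs c k * (of_real 0) ^ k))) (at (of_real 0))"
    by (rule termdiffs_strong_converges_everywhere)
  \<comment> \<open>At 0 only the term of index 0 survives; in the differentiated series it is
    \<open>c 1\<close>, the entry of X itself.\<close>
  moreover have "suminf (\<lambda>k. diffs c k * (of_real 0) ^ k) = X $$ (i, j)"
    using powser_zero[of "diffs c"] X by (simp add: diffs_def c_def)
  ultimately have "((\<lambda>x. suminf (\<lambda>k. c k * x ^ k)) has_field_derivative X $$ (i, j)) (at (of_real 0))"
    by simp
  from has_vector_derivative_real_field[OF this, of UNIV]
  have "((\<lambda>s::real. suminf (\<lambda>k. c k * of_real s ^ k)) has_vector_derivative X $$ (i, j)) (at 0)" .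
  moreover have "mexp N (complex_of_real s \<cdot>\<^sub>m X) $$ (i, j) = (suminf (\<lambda>k. c k * of_real s ^ k))" for s
  proof -
    have "((complex_of_real s \<cdot>\<^sub>m X) ^\<^sub>m k) $$ (i, j) / of_nat (fact k) = c k * of_real s ^ k" for k
      using ij X pow_carrier_mat[OF X, of k] by (simp add: smult_pow_mat[OF X] c_def)
    then show ?thesis using ij by (simp add: mexp_def)
  qed
  ultimately show ?thesis by simp
qed

text \<open>The product rule at s = 0 leaves undifferentiated factors at the point V exp(0 X); this
  identity turns them into values at V.\<close>

lemma mexp_zero:
  assumes X: "X \<in> carrier_mat N N"
  shows "mexp N (0 \<cdot>\<^sub>m X) = 1\<^sub>m N"
proof (rule eq_matI)
  fix i j assume "i < dim_row (1\<^sub>m N :: complex mat)" "j < dim_col (1\<^sub>m N :: complex mat)"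
  then have ij: "i < N" "j < N" by auto
  have "((0 \<cdot>\<^sub>m X) ^\<^sub>m k) $$ (i, j) / of_nat (fact k) = (X ^\<^sub>m k) $$ (i, j) / of_nat (fact k) * 0 ^ k" for k
    using ij X pow_carrier_mat[OF X, of k] by (simp add: smult_pow_mat[OF X])
  then have "mexp N (0 \<cdot>\<^sub>m X) $$ (i, j) = (X ^\<^sub>m 0) $$ (i, j) / of_nat (fact 0)"
    using ij powser_zero[of "\<lambda>k. (X ^\<^sub>m k) $$ (i, j) / of_nat (fact k)"]
    by (simp add: mexp_def)
  then show "mexp N (0 \<cdot>\<^sub>m X) $$ (i, j) = 1\<^sub>m N $$ (i, j)"
    using X by simp
qed (auto simp: mexp_def)

section \<open>Left-invariant derivatives\<close>

text \<open>The derivative is required at every matrix, not only at unitary ones, so that no property of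
  the exponential beyond its value and derivative at \<open>0\<close> is needed.\<close>

definition lderiv :: "nat \<Rightarrow> complex mat \<Rightarrow> (complex mat \<Rightarrow> complex) \<Rightarrow> (complex mat \<Rightarrow> complex) \<Rightarrow> bool" where
  "lderiv N X f f' \<longleftrightarrow> (\<forall>V\<in>carrier_mat N N.
     ((\<lambda>s::real. f (V * mexp N (complex_of_real s \<cdot>\<^sub>m X))) has_vector_derivative f' V) (at 0))"

lemma lderiv_const: "lderiv N X (\<lambda>V. c) (\<lambda>V. 0)"
  by (simp add: lderiv_def)

lemma lderiv_add:
  "lderiv N X f f' \<Longrightarrow> lderiv N X g g' \<Longrightarrow> lderiv N X (\<lambda>V. f V + g V) (\<lambda>V. f' V + g' V)"
  by (auto simp: lderiv_def intro!: derivative_intros)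

lemma lderiv_sum:
  "(\<And>a. a \<in> A \<Longrightarrow> lderiv N X (f a) (f' a)) \<Longrightarrow>
    lderiv N X (\<lambda>V. \<Sum>a\<in>A. f a V) (\<lambda>V. \<Sum>a\<in>A. f' a V)"
  by (auto simp: lderiv_def intro!: derivative_intros)

lemma lderiv_mult:
  assumes X: "X \<in> carrier_mat N N" and "lderiv N X f f'" "lderiv N X g g'"
  shows "lderiv N X (\<lambda>V. f V * g V) (\<lambda>V. f' V * g V + f V * g' V)"
  unfolding lderiv_def
proof
  fix V :: "complex mat" assume V: "V \<in> carrier_mat N N"
  show "((\<lambda>s::real. f (V * mexp N (complex_of_real s \<cdot>\<^sub>m X)) * g (V * mexp N (complex_of_real s \<cdot>\<^sub>m X)))
      has_vector_derivative f' V * g V + f V * g' V) (at 0)"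
    using has_vector_derivative_mult[OF assms(2)[unfolded lderiv_def, rule_format, OF V]
        assms(3)[unfolded lderiv_def, rule_format, OF V]] V
    by (simp add: mexp_zero[OF X] add.commute)
qed

lemma lderiv_entry:
  assumes X: "X \<in> carrier_mat N N" and ij: "i < N" "j < N"
  shows "lderiv N X (\<lambda>V. V $$ (i, j)) (\<lambda>V. \<Sum>r<N. V $$ (i, r) * X $$ (r, j))"
  unfolding lderiv_def
proof
  fix V :: "complex mat" assume V: "V \<in> carrier_mat N N"
  have "(V * mexp N (complex_of_real s \<cdot>\<^sub>m X)) $$ (i, j)
      = (\<Sum>r<N. V $$ (i, r) * mexp N (complex_of_real s \<cdot>\<^sub>m X) $$ (r, j))" for s
    using V ij mexp_carrier[of N "complex_of_real s \<cdot>\<^sub>m X"]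
    by (simp add: scalar_prod_def atLeast0LessThan)
  moreover have "((\<lambda>s. \<Sum>r<N. V $$ (i, r) * mexp N (complex_of_real s \<cdot>\<^sub>m X) $$ (r, j))
      has_vector_derivative (\<Sum>r<N. V $$ (i, r) * X $$ (r, j))) (at 0)"
    by (intro derivative_intros mexp_entry_has_vector_derivative[OF X]) (use ij in auto)
  ultimately show "((\<lambda>s. (V * mexp N (complex_of_real s \<cdot>\<^sub>m X)) $$ (i, j))
      has_vector_derivative (\<Sum>r<N. V $$ (i, r) * X $$ (r, j))) (at 0)"
    by simp
qed

text \<open>The curve through V stays among the N by N matrices, so agreement there is
  enough.\<close>

lemma lderiv_cong:
  assumes X: "X \<in> carrier_mat N N" and "lderiv N X f f'"
    and "\<And>V. V \<in> carrier_mat N N \<Longrightarrow> f V = g V" "\<And>V. V \<in> carrier_mat N N \<Longrightarrow> f' V = g' V"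
  shows "lderiv N X g g'"
proof -
  have "f (V * mexp N (complex_of_real s \<cdot>\<^sub>m X)) = g (V * mexp N (complex_of_real s \<cdot>\<^sub>m X))"
    if "V \<in> carrier_mat N N" for V s
    using assms(3) mult_carrier_mat[OF that mexp_carrier] by blast
  then show ?thesis using assms(2,4) by (simp add: lderiv_def)
qed

lemma lvf_eq_lderiv: "lderiv N X f f' \<Longrightarrow> V \<in> carrier_mat N N \<Longrightarrow> lvf N X f V = f' V"
  by (simp add: lderiv_def lvf_def vector_derivative_at)

text \<open>The value of \<open>vector_derivative\<close>, hence of \<open>lvf\<close>, is
  uninformative where no derivative exists, so existence has to be carried along. Quantifying the
  derivatives existentially spares the closure lemmas any explicit second derivative.\<close>

definition twice_lderiv :: "nat \<Rightarrow> (complex mat \<Rightarrow> complex) \<Rightarrow> bool" where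
  "twice_lderiv N f \<longleftrightarrow> (\<forall>X\<in>carrier_mat N N. \<exists>f' f''. lderiv N X f f' \<and> lderiv N X f' f'')"

lemma lvf_cong:
  assumes "\<And>V. V \<in> carrier_mat N N \<Longrightarrow> f V = g V" and "V \<in> carrier_mat N N"
  shows "lvf N X f V = lvf N X g V"
proof -
  have "f (V * mexp N (complex_of_real s \<cdot>\<^sub>m X)) = g (V * mexp N (complex_of_real s \<cdot>\<^sub>m X))" for s
    using assms(1) mult_carrier_mat[OF assms(2) mexp_carrier] by blast
  then show ?thesis by (simp add: lvf_def)
qed

text \<open>The anonymous derivative agrees with \<open>lvf\<close> at every N by N matrix, not just
  at one point; this is what lets the second derivative be identified as well.\<close>

lemma lderiv_lvf:
  assumes "twice_lderiv N f" and X: "X \<in> carrier_mat N N"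
  shows "lderiv N X f (lvf N X f)" "lderiv N X (lvf N X f) (lvf N X (lvf N X f))"
proof -
  obtain f' f'' where f: "lderiv N X f f'" "lderiv N X f' f''"
    using assms by (auto simp: twice_lderiv_def)
  have 1: "lvf N X f V = f' V" if "V \<in> carrier_mat N N" for V
    using lvf_eq_lderiv[OF f(1) that] .
  then have 2: "lvf N X (lvf N X f) V = f'' V" if "V \<in> carrier_mat N N" for V
    using lvf_cong[of N "lvf N X f" f' V X] lvf_eq_lderiv[OF f(2)] that by simp
  show "lderiv N X f (lvf N X f)"
    by (rule lderiv_cong[OF X f(1)]) (simp_all add: 1)
  show "lderiv N X (lvf N X f) (lvf N X (lvf N X f))"
    by (rule lderiv_cong[OF X f(2)]) (simp_all add: 1 2)
qed

lemma twice_lderiv_const: "twice_lderiv N (\<lambda>V. c)"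
  unfolding twice_lderiv_def
  by (rule ballI, rule exI, rule exI, rule conjI[OF lderiv_const lderiv_const])

lemma twice_lderiv_sum:
  assumes "\<And>a. a \<in> A \<Longrightarrow> twice_lderiv N (f a)"
  shows "twice_lderiv N (\<lambda>V. \<Sum>a\<in>A. f a V)"
  unfolding twice_lderiv_def
proof
  fix X :: "complex mat" assume X: "X \<in> carrier_mat N N"
  show "\<exists>f' f''. lderiv N X (\<lambda>V. \<Sum>a\<in>A. f a V) f' \<and> lderiv N X f' f''"
    by (rule exI, rule exI, rule conjI[OF lderiv_sum[OF lderiv_lvf(1)[OF assms X]]
          lderiv_sum[OF lderiv_lvf(2)[OF assms X]]])
qed

lemma twice_lderiv_mult:
  assumes "twice_lderiv N f" "twice_lderiv N g"
  shows "twice_lderiv N (\<lambda>V. f V * g V)"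
  unfolding twice_lderiv_def
proof
  fix X :: "complex mat" assume X: "X \<in> carrier_mat N N"
  note f = lderiv_lvf[OF assms(1) X] and g = lderiv_lvf[OF assms(2) X]
  show "\<exists>f' f''. lderiv N X (\<lambda>V. f V * g V) f' \<and> lderiv N X f' f''"
    by (rule exI, rule exI, rule conjI[OF lderiv_mult[OF X f(1) g(1)]
          lderiv_add[OF lderiv_mult[OF X f(2) g(1)] lderiv_mult[OF X f(1) g(2)]]])
qed

lemma twice_lderiv_power: "twice_lderiv N f \<Longrightarrow> twice_lderiv N (\<lambda>V. f V ^ k)"
  by (induction k) (auto intro: twice_lderiv_const twice_lderiv_mult)

lemma twice_lderiv_prod:
  "(\<And>a. a \<in> A \<Longrightarrow> twice_lderiv N (f a)) \<Longrightarrow> twice_lderiv N (\<lambda>V. \<Prod>a\<in>A. f a V)"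
  by (induction A rule: infinite_finite_induct) (auto intro: twice_lderiv_const twice_lderiv_mult)

lemma twice_lderiv_cong:
  assumes "twice_lderiv N f" "\<And>V. V \<in> carrier_mat N N \<Longrightarrow> f V = g V"
  shows "twice_lderiv N g"
  unfolding twice_lderiv_def
proof
  fix X :: "complex mat" assume X: "X \<in> carrier_mat N N"
  show "\<exists>f' f''. lderiv N X g f' \<and> lderiv N X f' f''"
    by (rule exI, rule exI, rule conjI[OF lderiv_cong[OF X lderiv_lvf(1)[OF assms(1) X] assms(2) refl]
          lderiv_lvf(2)[OF assms(1) X]])
qed

text \<open>The first derivative is an entry of V X. Since X is constant, differentiating once more
  gives the entry of V X X.\<close>

lemma lderiv_entry_second:
  assumes X: "X \<in> carrier_mat N N" and "i < N" "j < N"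
  shows "lderiv N X (\<lambda>V. \<Sum>r<N. V $$ (i, r) * X $$ (r, j))
    (\<lambda>V. \<Sum>r<N. \<Sum>q<N. V $$ (i, q) * (X $$ (q, r) * X $$ (r, j)))"
proof (rule lderiv_sum)
  fix r assume "r \<in> {..<N}"
  then have "lderiv N X (\<lambda>V. V $$ (i, r) * X $$ (r, j))
      (\<lambda>V. (\<Sum>q<N. V $$ (i, q) * X $$ (q, r)) * X $$ (r, j) + V $$ (i, r) * 0)"
    using assms by (intro lderiv_mult lderiv_entry lderiv_const) auto
  then show "lderiv N X (\<lambda>V. V $$ (i, r) * X $$ (r, j))
      (\<lambda>V. \<Sum>q<N. V $$ (i, q) * (X $$ (q, r) * X $$ (r, j)))"
    by (simp add: sum_distrib_right mult.assoc)
qed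

lemma twice_lderiv_entry: "i < N \<Longrightarrow> j < N \<Longrightarrow> twice_lderiv N (\<lambda>V. V $$ (i, j))"
  unfolding twice_lderiv_def
  by (rule ballI, rule exI, rule exI, rule conjI[OF lderiv_entry lderiv_entry_second])

lemma pow_mat_entry_Suc:
  fixes U :: "'a::semiring_1 mat"
  assumes U: "U \<in> carrier_mat N N" and "i < N" "j < N"
  shows "(U ^\<^sub>m Suc k) $$ (i, j) = (\<Sum>r<N. (U ^\<^sub>m k) $$ (i, r) * U $$ (r, j))"
  using pow_mat_entry_add[OF assms, of k 1] U by simp

lemma twice_lderiv_pow_entry:
  "i < N \<Longrightarrow> j < N \<Longrightarrow> twice_lderiv N (\<lambda>V. (V ^\<^sub>m k) $$ (i, j))"
proof (induction k arbitrary: i j)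
  case 0
  show ?case
    by (rule twice_lderiv_cong[OF twice_lderiv_const[of N "1\<^sub>m N $$ (i, j)"]]) auto
next
  case (Suc k)
  show ?case
  proof (rule twice_lderiv_cong)
    show "twice_lderiv N (\<lambda>V. \<Sum>r<N. (V ^\<^sub>m k) $$ (i, r) * V $$ (r, j))"
      using Suc by (intro twice_lderiv_sum twice_lderiv_mult twice_lderiv_entry) auto
  qed (simp add: pow_mat_entry_Suc[OF _ Suc.prems] del: pow_mat.simps)
qed

lemma twice_lderiv_ntr_pow: "twice_lderiv N (\<lambda>V. ntr N (V ^\<^sub>m k))"
proof -
  have "twice_lderiv N (\<lambda>V. (\<Sum>i<N. (V ^\<^sub>m k) $$ (i, i)) * (1 / of_nat N))"
    by (intro twice_lderiv_sum twice_lderiv_mult twice_lderiv_const twice_lderiv_pow_entry) auto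
  then show ?thesis by (simp add: ntr_def)
qed

text \<open>Moving along V exp(s X) inserts X directly after a letter V. In a power this can happen
  after the a-th letter, whence V^a X V^(k-a) with a running from 1 and not from 0.\<close>

lemma lderiv_pow_entry:
  assumes X: "X \<in> carrier_mat N N"
  shows "i < N \<Longrightarrow> j < N \<Longrightarrow> lderiv N X (\<lambda>V. (V ^\<^sub>m k) $$ (i, j))
    (\<lambda>V. \<Sum>a=1..k. \<Sum>p<N. \<Sum>q<N. (V ^\<^sub>m a) $$ (i, p) * X $$ (p, q) * (V ^\<^sub>m (k - a)) $$ (q, j))"
proof (induction k arbitrary: i j)
  case 0
  show ?case
    by (rule lderiv_cong[OF X lderiv_const[of N X "1\<^sub>m N $$ (i, j)"]]) auto
next
  case (Suc k)
  let ?T = "\<lambda>V i j. \<Sum>a=1..k. \<Sum>p<N. \<Sum>q<N. (V ^\<^sub>m a) $$ (i, p) * X $$ (p, q) * (V ^\<^sub>m (k - a)) $$ (q, j)"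
  show ?case
  proof (rule lderiv_cong[OF X])
    show "lderiv N X (\<lambda>V. \<Sum>r<N. (V ^\<^sub>m k) $$ (i, r) * V $$ (r, j))
        (\<lambda>V. \<Sum>r<N. ?T V i r * V $$ (r, j) + (V ^\<^sub>m k) $$ (i, r) * (\<Sum>s<N. V $$ (r, s) * X $$ (s, j)))"
      using Suc by (intro lderiv_sum lderiv_mult[OF X] lderiv_entry[OF X]) auto
  next
    fix V :: "complex mat" assume V: "V \<in> carrier_mat N N"
    show "(\<Sum>r<N. (V ^\<^sub>m k) $$ (i, r) * V $$ (r, j)) = (V ^\<^sub>m Suc k) $$ (i, j)"
      using pow_mat_entry_Suc[OF V Suc.prems] by simp
    have "(\<Sum>r<N. ?T V i r * V $$ (r, j)) =
        (\<Sum>a=1..k. \<Sum>p<N. \<Sum>q<N. (V ^\<^sub>m a) $$ (i, p) * X $$ (p, q) * (\<Sum>r<N. (V ^\<^sub>m (k - a)) $$ (q, r) * V $$ (r, j)))"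
      unfolding sum_distrib_right sum_distrib_left
      by (subst sum.swap[of _ _ "{..<N}"], rule sum.cong[OF refl],
          subst sum.swap[of _ _ "{..<N}"], rule sum.cong[OF refl],
          subst sum.swap[of _ _ "{..<N}"]) (simp add: mult.assoc)
    also have "\<dots> = (\<Sum>a=1..k. \<Sum>p<N. \<Sum>q<N. (V ^\<^sub>m a) $$ (i, p) * X $$ (p, q) * (V ^\<^sub>m (Suc k - a)) $$ (q, j))"
    proof (intro sum.cong refl)
      fix a p q assume "a \<in> {1..k}" and "q \<in> {..<N}"
      then show "(V ^\<^sub>m a) $$ (i, p) * X $$ (p, q) * (\<Sum>r<N. (V ^\<^sub>m (k - a)) $$ (q, r) * V $$ (r, j))
          = (V ^\<^sub>m a) $$ (i, p) * X $$ (p, q) * (V ^\<^sub>m (Suc k - a)) $$ (q, j)"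
        using pow_mat_entry_Suc[OF V _ Suc.prems(2), of q "k - a"] by (simp add: Suc_diff_le)
    qed
    finally have 1: "(\<Sum>r<N. ?T V i r * V $$ (r, j)) = \<dots>" .
    have "(\<Sum>r<N. (V ^\<^sub>m k) $$ (i, r) * (\<Sum>s<N. V $$ (r, s) * X $$ (s, j)))
        = (\<Sum>s<N. (\<Sum>r<N. (V ^\<^sub>m k) $$ (i, r) * V $$ (r, s)) * X $$ (s, j))"
      unfolding sum_distrib_right sum_distrib_left
      by (subst sum.swap) (simp add: mult.assoc)
    also have "\<dots> = (\<Sum>s<N. (V ^\<^sub>m Suc k) $$ (i, s) * X $$ (s, j))"
      using pow_mat_entry_Suc[OF V Suc.prems(1), of _ k] by (intro sum.cong) auto
    \<comment> \<open>The exponent \<open>Suc k - Suc k\<close> is 0: an identity matrix is appended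
      so that the insertion after the last letter takes the shape of the summand a = k + 1.\<close>
    also have "\<dots> = (\<Sum>p<N. \<Sum>q<N. (V ^\<^sub>m Suc k) $$ (i, p) * X $$ (p, q) * (V ^\<^sub>m (Suc k - Suc k)) $$ (q, j))"
    proof (intro sum.cong refl)
      fix p assume "p \<in> {..<N}"
      have "(\<Sum>q<N. (V ^\<^sub>m Suc k) $$ (i, p) * X $$ (p, q) * (V ^\<^sub>m (Suc k - Suc k)) $$ (q, j))
          = (\<Sum>q<N. if q = j then (V ^\<^sub>m Suc k) $$ (i, p) * X $$ (p, q) else 0)"
        using V Suc.prems by (intro sum.cong) auto
      then show "(V ^\<^sub>m Suc k) $$ (i, p) * X $$ (p, j) =
          (\<Sum>q<N. (V ^\<^sub>m Suc k) $$ (i, p) * X $$ (p, q) * (V ^\<^sub>m (Suc k - Suc k)) $$ (q, j))"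
        using Suc.prems by simp
    qed
    finally have 2: "(\<Sum>r<N. (V ^\<^sub>m k) $$ (i, r) * (\<Sum>s<N. V $$ (r, s) * X $$ (s, j))) = \<dots>" .
    show "(\<Sum>r<N. ?T V i r * V $$ (r, j) + (V ^\<^sub>m k) $$ (i, r) * (\<Sum>s<N. V $$ (r, s) * X $$ (s, j)))
      = (\<Sum>a=1..Suc k. \<Sum>p<N. \<Sum>q<N. (V ^\<^sub>m a) $$ (i, p) * X $$ (p, q) * (V ^\<^sub>m (Suc k - a)) $$ (q, j))"
      unfolding sum.distrib 1 2 by (simp del: pow_mat.simps)
  qed
qed

lemma lvf_sum:
  assumes "\<And>a. a \<in> A \<Longrightarrow> twice_lderiv N (f a)" "X \<in> carrier_mat N N" "V \<in> carrier_mat N N"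
  shows "lvf N X (\<lambda>V. \<Sum>a\<in>A. f a V) V = (\<Sum>a\<in>A. lvf N X (f a) V)"
    "lvf N X (lvf N X (\<lambda>V. \<Sum>a\<in>A. f a V)) V = (\<Sum>a\<in>A. lvf N X (lvf N X (f a)) V)"
proof -
  have 1: "lvf N X (\<lambda>V. \<Sum>a\<in>A. f a V) V = (\<Sum>a\<in>A. lvf N X (f a) V)" if "V \<in> carrier_mat N N" for V
    using lderiv_sum[OF lderiv_lvf(1)[OF assms(1,2)]] that by (rule lvf_eq_lderiv)
  have "lvf N X (lvf N X (\<lambda>V. \<Sum>a\<in>A. f a V)) V = lvf N X (\<lambda>V. \<Sum>a\<in>A. lvf N X (f a) V) V"
    using 1 assms(3) by (rule lvf_cong)
  also have "\<dots> = (\<Sum>a\<in>A. lvf N X (lvf N X (f a)) V)"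
    using lderiv_sum[OF lderiv_lvf(2)[OF assms(1,2)]] assms(3) by (rule lvf_eq_lderiv)
  finally show "lvf N X (lvf N X (\<lambda>V. \<Sum>a\<in>A. f a V)) V = (\<Sum>a\<in>A. lvf N X (lvf N X (f a)) V)" .
  show "lvf N X (\<lambda>V. \<Sum>a\<in>A. f a V) V = (\<Sum>a\<in>A. lvf N X (f a) V)"
    using 1 assms(3) .
qed

lemma lvf_mult:
  assumes "twice_lderiv N f" "twice_lderiv N g" and X: "X \<in> carrier_mat N N" and V: "V \<in> carrier_mat N N"
  shows "lvf N X (\<lambda>V. f V * g V) V = lvf N X f V * g V + f V * lvf N X g V"
    "lvf N X (lvf N X (\<lambda>V. f V * g V)) V
      = lvf N X (lvf N X f) V * g V + f V * lvf N X (lvf N X g) V + 2 * (lvf N X f V * lvf N X g V)"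
proof -
  note f = lderiv_lvf[OF assms(1) X] and g = lderiv_lvf[OF assms(2) X]
  have 1: "lvf N X (\<lambda>V. f V * g V) V = lvf N X f V * g V + f V * lvf N X g V" if "V \<in> carrier_mat N N" for V
    using lderiv_mult[OF X f(1) g(1)] that by (rule lvf_eq_lderiv)
  have "lvf N X (lvf N X (\<lambda>V. f V * g V)) V = lvf N X (\<lambda>V. lvf N X f V * g V + f V * lvf N X g V) V"
    using 1 V by (rule lvf_cong)
  also have "\<dots> = (lvf N X (lvf N X f) V * g V + lvf N X f V * lvf N X g V)
      + (lvf N X f V * lvf N X g V + f V * lvf N X (lvf N X g) V)"
    using lderiv_add[OF lderiv_mult[OF X f(2) g(1)] lderiv_mult[OF X f(1) g(2)]] V
    by (rule lvf_eq_lderiv)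
  finally show "lvf N X (lvf N X (\<lambda>V. f V * g V)) V
      = lvf N X (lvf N X f) V * g V + f V * lvf N X (lvf N X g) V + 2 * (lvf N X f V * lvf N X g V)"
    by simp
  show "lvf N X (\<lambda>V. f V * g V) V = lvf N X f V * g V + f V * lvf N X g V"
    using 1 V .
qed

lemma lvf_const:
  assumes V: "V \<in> carrier_mat N N"
  shows "lvf N X (\<lambda>V. c) V = 0" "lvf N X (lvf N X (\<lambda>V. c)) V = 0"
proof -
  have 1: "lvf N X (\<lambda>V. c) V = 0" if "V \<in> carrier_mat N N" for V c
    using lvf_eq_lderiv[OF lderiv_const that] .
  show "lvf N X (\<lambda>V. c) V = 0" using 1 V .
  show "lvf N X (lvf N X (\<lambda>V. c)) V = 0"
    using lvf_cong[OF 1[of _ c] V, where X = X] 1[OF V, of 0] by simp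
qed

section \<open>Completeness of orthonormal bases\<close>

lemma ip_N_skew:
  assumes "X \<in> lie_u N" "Y \<in> carrier_mat N N"
  shows "ip_N N X Y = real N * Re (\<Sum>i<N. \<Sum>r<N. - (X $$ (i, r)) * Y $$ (r, i))"
proof -
  have X: "X \<in> carrier_mat N N" "adj N X = - X" using assms by (auto simp: lie_u_def)
  have "(adj N X * Y) $$ (i, i) = (\<Sum>r<N. - (X $$ (i, r)) * Y $$ (r, i))" if "i < N" for i
    using X assms(2) that by (simp add: X(2) scalar_prod_def atLeast0LessThan sum_negf)
  then show ?thesis by (simp add: ip_N_def)
qed

lemma lie_u_entry:
  assumes "X \<in> lie_u N" "i < N" "j < N"
  shows "cnj (X $$ (j, i)) = - X $$ (i, j)"
proof -
  have "adj N X $$ (i, j) = (- X) $$ (i, j)" "X \<in> carrier_mat N N" using assms by (auto simp: lie_u_def)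
  then show ?thesis using assms by (simp add: adj_def)
qed

lemma lie_uI:
  assumes "X \<in> carrier_mat N N" "\<And>i j. i < N \<Longrightarrow> j < N \<Longrightarrow> cnj (X $$ (j, i)) = - X $$ (i, j)"
  shows "X \<in> lie_u N"
proof -
  have "adj N X = - X"
    by (rule eq_matI) (use assms in \<open>simp_all add: adj_def\<close>)
  then show ?thesis using assms(1) by (simp add: lie_u_def)
qed

lemma orthonormal_basis_expansion:
  assumes B: "orthonormal_basis_u N B" and Z: "Z \<in> lie_u N" and ij: "i < N" "j < N"
  shows "Z $$ (i, j) = - of_nat N * (\<Sum>Y\<in>B. (\<Sum>a<N. \<Sum>b<N. Y $$ (a, b) * Z $$ (b, a)) * Y $$ (i, j))"
proof -
  have BL: "B \<subseteq> lie_u N" and fin: "finite B" using B by (auto simp: orthonormal_basis_u_def)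
  obtain c :: "complex mat \<Rightarrow> real" where
    c: "\<And>i j. i < N \<Longrightarrow> j < N \<Longrightarrow> Z $$ (i, j) = (\<Sum>Y\<in>B. complex_of_real (c Y) * Y $$ (i, j))"
    using B Z unfolding orthonormal_basis_u_def by blast
  have "complex_of_real (c Y) = - of_nat N * (\<Sum>a<N. \<Sum>b<N. Y $$ (a, b) * Z $$ (b, a))" if Y: "Y \<in> B" for Y
  proof -
    \<comment> \<open>Conjugation transposes both factors and changes the sign of each; the signs
      cancel and the transposed double sum is the same sum.\<close>
    have tr_real: "(\<Sum>a<N. \<Sum>b<N. Y $$ (a, b) * W $$ (b, a)) \<in> \<real>" if "W \<in> lie_u N" for W
    proof -
      have "cnj (\<Sum>a<N. \<Sum>b<N. Y $$ (a, b) * W $$ (b, a)) = (\<Sum>a<N. \<Sum>b<N. Y $$ (b, a) * W $$ (a, b))"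
        using lie_u_entry[of Y N] lie_u_entry[OF that] Y BL by (auto intro!: sum.cong)
      also have "\<dots> = (\<Sum>a<N. \<Sum>b<N. Y $$ (a, b) * W $$ (b, a))"
        by (rule sum.swap)
      finally show ?thesis by (simp add: Reals_cnj_iff)
    qed
    have ip: "- of_nat N * (\<Sum>a<N. \<Sum>b<N. Y $$ (a, b) * W $$ (b, a)) = complex_of_real (ip_N N Y W)"
      if W: "W \<in> lie_u N" for W
    proof -
      have "W \<in> carrier_mat N N" "Y \<in> lie_u N" using W Y BL by (auto simp: lie_u_def)
      then show ?thesis
        using of_real_Re[OF tr_real[OF W]] by (simp add: ip_N_skew sum_negf)
    qed
    have "(\<Sum>a<N. \<Sum>b<N. Y $$ (a, b) * Z $$ (b, a))
        = (\<Sum>a<N. \<Sum>b<N. \<Sum>W\<in>B. c W * (Y $$ (a, b) * W $$ (b, a)))"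
      by (intro sum.cong refl) (simp add: c sum_distrib_left mult_ac)
    also have "\<dots> = (\<Sum>W\<in>B. c W * (\<Sum>a<N. \<Sum>b<N. Y $$ (a, b) * W $$ (b, a)))"
      unfolding sum_distrib_left
      by (subst (2) sum.swap, subst sum.swap) (rule refl)
    finally have "- of_nat N * (\<Sum>a<N. \<Sum>b<N. Y $$ (a, b) * Z $$ (b, a))
        = (\<Sum>W\<in>B. c W * (- of_nat N * (\<Sum>a<N. \<Sum>b<N. Y $$ (a, b) * W $$ (b, a))))"
      by (simp add: sum_distrib_left[of _ _ B] mult.left_commute sum_negf)
    also have "\<dots> = (\<Sum>W\<in>B. if W = Y then complex_of_real (c W) else 0)"
    proof (rule sum.cong[OF refl])
      fix W assume W: "W \<in> B"
      then have "ip_N N Y W = (if W = Y then 1 else 0)"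
        using B Y unfolding orthonormal_basis_u_def by auto
      then show "c W * (- of_nat N * (\<Sum>a<N. \<Sum>b<N. Y $$ (a, b) * W $$ (b, a)))
          = (if W = Y then complex_of_real (c W) else 0)"
        unfolding ip[OF subsetD[OF BL W]] by simp
    qed
    also have "\<dots> = complex_of_real (c Y)" using fin Y by simp
    finally show ?thesis by simp
  qed
  then have "Z $$ (i, j) = (\<Sum>Y\<in>B. - of_nat N * (\<Sum>a<N. \<Sum>b<N. Y $$ (a, b) * Z $$ (b, a)) * Y $$ (i, j))"
    using c[OF ij] by simp
  then show ?thesis
    by (simp add: sum_distrib_left[of _ _ B] mult.assoc sum_negf)
qed

text \<open>The expansion formula is complex linear, so it extends from skew-Hermitian matrices to
  the matrix unit with its 1 in position (b, a). Pairing this unit with Y under the trace reads off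
  \<open>Y $$ (a, b)\<close>, and comparing the entries at (c, d) gives the relation.\<close>

lemma orthonormal_basis_completeness:
  assumes B: "orthonormal_basis_u N B" and "a < N" "b < N" "c < N" "d < N"
  shows "(\<Sum>Y\<in>B. Y $$ (a, b) * Y $$ (c, d)) = - (if a = d \<and> b = c then 1 / of_nat N else 0)"
proof -
  define E :: "nat \<Rightarrow> nat \<Rightarrow> nat \<Rightarrow> nat \<Rightarrow> complex"
    where "E p q i j = (if i = p \<and> j = q then 1 else 0)" for p q i j
  \<comment> \<open>\<open>2 E\<^sub>b\<^sub>a = Z1 - \<i> Z2\<close> reduces the complex matrix unit to two skew-Hermitian matrices.\<close>
  define Z1 where "Z1 = mat N N (\<lambda>(i, j). E b a i j - E a b i j)"
  define Z2 where "Z2 = mat N N (\<lambda>(i, j). \<i> * (E b a i j + E a b i j))"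
  have E: "cnj (E p q i j) = E p q i j" "E p q j i = E q p i j" for p q i j
    by (auto simp: E_def)
  have Z: "Z1 \<in> lie_u N" "Z2 \<in> lie_u N"
  proof -
    show "Z1 \<in> lie_u N"
    proof (rule lie_uI)
      fix i j assume "i < N" "j < N"
      then show "cnj (Z1 $$ (j, i)) = - Z1 $$ (i, j)"
        using E(2)[of b a j i] E(2)[of a b j i] by (simp add: Z1_def E(1))
    qed (simp add: Z1_def)
    show "Z2 \<in> lie_u N"
    proof (rule lie_uI)
      fix i j assume "i < N" "j < N"
      then show "cnj (Z2 $$ (j, i)) = - Z2 $$ (i, j)"
        using E(2)[of b a j i] E(2)[of a b j i] by (simp add: Z2_def E(1) algebra_simps)
    qed (simp add: Z2_def)
  qed
  have comb: "Z1 $$ (i, j) - \<i> * Z2 $$ (i, j) = 2 * E b a i j" if "i < N" "j < N" for i j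
    using that by (simp add: Z1_def Z2_def algebra_simps)
  have pair: "(\<Sum>p<N. \<Sum>q<N. Y $$ (p, q) * E b a q p) = Y $$ (a, b)" for Y :: "complex mat"
  proof -
    have "(\<Sum>p<N. \<Sum>q<N. Y $$ (p, q) * E b a q p) = (\<Sum>p<N. if p = a then Y $$ (a, b) else 0)"
    proof (rule sum.cong[OF refl])
      fix p
      have "(\<Sum>q<N. Y $$ (p, q) * E b a q p) = (\<Sum>q<N. if q = b then (if p = a then Y $$ (p, b) else 0) else 0)"
        by (intro sum.cong) (auto simp: E_def)
      then show "(\<Sum>q<N. Y $$ (p, q) * E b a q p) = (if p = a then Y $$ (a, b) else 0)"
        using assms by simp
    qed
    then show ?thesis using assms by simp
  qed
  have tr: "(\<Sum>p<N. \<Sum>q<N. Y $$ (p, q) * Z1 $$ (q, p)) - \<i> * (\<Sum>p<N. \<Sum>q<N. Y $$ (p, q) * Z2 $$ (q, p))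
      = 2 * Y $$ (a, b)" for Y :: "complex mat"
  proof -
    have "(\<Sum>p<N. \<Sum>q<N. Y $$ (p, q) * Z1 $$ (q, p)) - \<i> * (\<Sum>p<N. \<Sum>q<N. Y $$ (p, q) * Z2 $$ (q, p))
      = (\<Sum>p<N. \<Sum>q<N. Y $$ (p, q) * (Z1 $$ (q, p) - \<i> * Z2 $$ (q, p)))"
      by (simp add: sum_distrib_left sum_subtractf right_diff_distrib mult.left_commute)
    also have "\<dots> = (\<Sum>p<N. \<Sum>q<N. 2 * (Y $$ (p, q) * E b a q p))"
      by (intro sum.cong refl) (simp add: comb)
    finally show ?thesis by (simp add: pair sum_distrib_left[symmetric])
  qed
  have "2 * E b a c d = - of_nat N * (\<Sum>Y\<in>B. ((\<Sum>p<N. \<Sum>q<N. Y $$ (p, q) * Z1 $$ (q, p))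
      - \<i> * (\<Sum>p<N. \<Sum>q<N. Y $$ (p, q) * Z2 $$ (q, p))) * Y $$ (c, d))"
    using comb[of c d] assms orthonormal_basis_expansion[OF B Z(1), of c d]
      orthonormal_basis_expansion[OF B Z(2), of c d]
    by (simp add: left_diff_distrib sum_subtractf mult.assoc sum_distrib_left[symmetric] right_diff_distrib mult.left_commute[of "of_nat N" "\<i>"])
  also have "\<dots> = - of_nat N * (\<Sum>Y\<in>B. 2 * (Y $$ (a, b) * Y $$ (c, d)))"
    unfolding tr by (simp only: mult.assoc)
  also have "\<dots> = 2 * (- of_nat N * (\<Sum>Y\<in>B. Y $$ (a, b) * Y $$ (c, d)))"
    unfolding sum_distrib_left[symmetric] by (rule mult.left_commute)
  finally have S: "E b a c d = - of_nat N * (\<Sum>Y\<in>B. Y $$ (a, b) * Y $$ (c, d))"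
    by simp
  have "N \<noteq> 0" using assms by simp
  then have "(\<Sum>Y\<in>B. Y $$ (a, b) * Y $$ (c, d)) = - (E b a c d / of_nat N)"
    unfolding S by simp
  then show ?thesis by (simp add: E_def conj_commute)
qed

section \<open>The Laplacian and its carre du champ\<close>

locale onb_u =
  fixes N :: nat and B :: "complex mat set"
  assumes onb: "orthonormal_basis_u N B"
begin

definition lap :: "(complex mat \<Rightarrow> complex) \<Rightarrow> complex mat \<Rightarrow> complex" where
  "lap f U = (\<Sum>X\<in>B. lvf N X (lvf N X f) U)"

definition gam :: "(complex mat \<Rightarrow> complex) \<Rightarrow> (complex mat \<Rightarrow> complex) \<Rightarrow> complex mat \<Rightarrow> complex" where
  "gam f g U = (\<Sum>X\<in>B. lvf N X f U * lvf N X g U)"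

lemma B_carrier: "X \<in> B \<Longrightarrow> X \<in> carrier_mat N N"
  using onb by (auto simp: orthonormal_basis_u_def lie_u_def)

lemma lap_cong:
  assumes "\<And>V. V \<in> carrier_mat N N \<Longrightarrow> f V = g V" and "U \<in> carrier_mat N N"
  shows "lap f U = lap g U"
  unfolding lap_def by (intro sum.cong refl lvf_cong[OF lvf_cong] assms)

lemma gam_cong:
  assumes "\<And>V. V \<in> carrier_mat N N \<Longrightarrow> f V = f' V" "\<And>V. V \<in> carrier_mat N N \<Longrightarrow> g V = g' V"
    and "U \<in> carrier_mat N N"
  shows "gam f g U = gam f' g' U"
  unfolding gam_def
  using lvf_cong[of N f f', OF assms(1,3)] lvf_cong[of N g g', OF assms(2,3)] by simp

lemma gam_commute: "gam f g U = gam g f U"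
  by (simp add: gam_def mult.commute)

lemma lap_sum:
  assumes "\<And>a. a \<in> A \<Longrightarrow> twice_lderiv N (f a)" and U: "U \<in> carrier_mat N N"
  shows "lap (\<lambda>V. \<Sum>a\<in>A. f a V) U = (\<Sum>a\<in>A. lap (f a) U)"
proof -
  have "lap (\<lambda>V. \<Sum>a\<in>A. f a V) U = (\<Sum>X\<in>B. \<Sum>a\<in>A. lvf N X (lvf N X (f a)) U)"
    unfolding lap_def by (intro sum.cong refl lvf_sum(2) assms B_carrier)
  also have "\<dots> = (\<Sum>a\<in>A. lap (f a) U)"
    unfolding lap_def by (rule sum.swap)
  finally show ?thesis .
qed

lemma lap_mult:
  assumes "twice_lderiv N f" "twice_lderiv N g" and U: "U \<in> carrier_mat N N"
  shows "lap (\<lambda>V. f V * g V) U = lap f U * g U + f U * lap g U + 2 * gam f g U"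
proof -
  have "lap (\<lambda>V. f V * g V) U = (\<Sum>X\<in>B. lvf N X (lvf N X f) U * g U + f U * lvf N X (lvf N X g) U
      + 2 * (lvf N X f U * lvf N X g U))"
    unfolding lap_def by (intro sum.cong refl lvf_mult(2) assms B_carrier)
  then show ?thesis
    by (simp add: lap_def gam_def sum.distrib sum_distrib_left sum_distrib_right)
qed

lemma lap_const: "U \<in> carrier_mat N N \<Longrightarrow> lap (\<lambda>V. c) U = 0"
  by (simp add: lap_def lvf_const)

lemma gam_const: "U \<in> carrier_mat N N \<Longrightarrow> gam f (\<lambda>V. c) U = 0"
  by (simp add: gam_def lvf_const)

lemma gam_sum_right:
  assumes "\<And>a. a \<in> A \<Longrightarrow> twice_lderiv N (g a)" and U: "U \<in> carrier_mat N N"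
  shows "gam f (\<lambda>V. \<Sum>a\<in>A. g a V) U = (\<Sum>a\<in>A. gam f (g a) U)"
proof -
  have "gam f (\<lambda>V. \<Sum>a\<in>A. g a V) U = (\<Sum>X\<in>B. lvf N X f U * (\<Sum>a\<in>A. lvf N X (g a) U))"
    unfolding gam_def by (intro sum.cong refl arg_cong2[where f = "(*)"] lvf_sum(1) assms B_carrier)
  also have "\<dots> = (\<Sum>a\<in>A. gam f (g a) U)"
    unfolding gam_def sum_distrib_left by (rule sum.swap)
  finally show ?thesis .
qed

lemma gam_mult_right:
  assumes "twice_lderiv N g" "twice_lderiv N h" and U: "U \<in> carrier_mat N N"
  shows "gam f (\<lambda>V. g V * h V) U = gam f g U * h U + g U * gam f h U"
proof -
  have "gam f (\<lambda>V. g V * h V) U = (\<Sum>X\<in>B. lvf N X f U * (lvf N X g U * h U + g U * lvf N X h U))"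
    unfolding gam_def by (intro sum.cong refl arg_cong2[where f = "(*)"] lvf_mult(1) assms B_carrier)
  then show ?thesis
    by (simp add: gam_def distrib_left sum.distrib sum_distrib_left sum_distrib_right mult_ac)
qed

lemma lap_cmult:
  assumes "twice_lderiv N f" "U \<in> carrier_mat N N"
  shows "lap (\<lambda>V. c * f V) U = c * lap f U"
  using assms lap_mult[OF twice_lderiv_const assms(1), of U c]
  by (simp add: lap_const gam_const gam_commute[of "\<lambda>V. c"])

lemma gam_ntr_right:
  assumes "U \<in> carrier_mat N N"
  shows "gam f (\<lambda>V. ntr N (V ^\<^sub>m k)) U = (\<Sum>p<N. gam f (\<lambda>V. (V ^\<^sub>m k) $$ (p, p)) U) / of_nat N"
proof -
  have "gam f (\<lambda>V. (1 / of_nat N) * (\<Sum>i<N. (V ^\<^sub>m k) $$ (i, i))) U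
    = (1 / of_nat N) * (\<Sum>p<N. gam f (\<lambda>V. (V ^\<^sub>m k) $$ (p, p)) U)"
    using assms
    by (subst gam_mult_right; (subst gam_sum_right)?;
        auto intro!: twice_lderiv_const twice_lderiv_sum twice_lderiv_pow_entry simp: gam_const)
  then show ?thesis by (simp add: ntr_def)
qed

text \<open>Completeness re-pairs the four vectors crosswise: the left end of each chain meets the
  right end of the other, so \<alpha> goes with \<delta> and \<gamma> with \<beta>.\<close>

lemma sum_basis_contraction:
  fixes \<alpha> \<beta> \<gamma> \<delta> :: "nat \<Rightarrow> complex"
  shows "(\<Sum>X\<in>B. (\<Sum>s<N. \<Sum>t<N. \<alpha> s * X $$ (s, t) * \<beta> t) * (\<Sum>v<N. \<Sum>w<N. \<gamma> v * X $$ (v, w) * \<delta> w))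
    = - ((\<Sum>s<N. \<alpha> s * \<delta> s) * (\<Sum>t<N. \<gamma> t * \<beta> t)) / of_nat N"
proof -
  \<comment> \<open>\<open>H\<close> is general because the identity is used twice: to extract the
    first occurrence of X, with the other chain as \<open>H\<close>, and to extract the second, with
    a single entry as \<open>H\<close>.\<close>
  have swap: "(\<Sum>X\<in>B. (\<Sum>s<N. \<Sum>t<N. f s * X $$ (s, t) * g t) * H X)
      = (\<Sum>s<N. \<Sum>t<N. f s * g t * (\<Sum>X\<in>B. X $$ (s, t) * H X))"
    for f g :: "nat \<Rightarrow> complex" and H :: "complex mat \<Rightarrow> complex"
  proof -
    have "(\<Sum>X\<in>B. (\<Sum>s<N. \<Sum>t<N. f s * X $$ (s, t) * g t) * H X)
        = (\<Sum>X\<in>B. \<Sum>s<N. \<Sum>t<N. f s * g t * (X $$ (s, t) * H X))"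
      unfolding sum_distrib_right by (intro sum.cong refl) (simp only: mult_ac)
    also have "\<dots> = (\<Sum>s<N. \<Sum>X\<in>B. \<Sum>t<N. f s * g t * (X $$ (s, t) * H X))"
      by (rule sum.swap)
    also have "\<dots> = (\<Sum>s<N. \<Sum>t<N. \<Sum>X\<in>B. f s * g t * (X $$ (s, t) * H X))"
      by (intro sum.cong refl sum.swap)
    finally show ?thesis unfolding sum_distrib_left .
  qed
  have inner: "(\<Sum>X\<in>B. X $$ (s, t) * (\<Sum>v<N. \<Sum>w<N. \<gamma> v * X $$ (v, w) * \<delta> w)) = - (\<gamma> t * \<delta> s) / of_nat N"
    if "s < N" "t < N" for s t
  proof -
    have "(\<Sum>X\<in>B. X $$ (s, t) * (\<Sum>v<N. \<Sum>w<N. \<gamma> v * X $$ (v, w) * \<delta> w))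
      = (\<Sum>v<N. \<Sum>w<N. \<gamma> v * \<delta> w * (\<Sum>X\<in>B. X $$ (s, t) * X $$ (v, w)))"
      using swap[of \<gamma> \<delta> "\<lambda>X. X $$ (s, t)"] by (simp only: mult.commute[of "_ $$ (s, t)"])
    also have "\<dots> = (\<Sum>v<N. \<Sum>w<N. if w = s then (if v = t then - (\<gamma> t * \<delta> s) / of_nat N else 0) else 0)"
      using that by (intro sum.cong refl) (auto simp: orthonormal_basis_completeness[OF onb])
    also have "\<dots> = (\<Sum>v<N. if v = t then - (\<gamma> t * \<delta> s) / of_nat N else 0)"
      using that by simp
    also have "\<dots> = - (\<gamma> t * \<delta> s) / of_nat N"
      using that by simp
    finally show ?thesis .
  qed
  have "(\<Sum>s<N. \<Sum>t<N. \<alpha> s * \<beta> t * (- (\<gamma> t * \<delta> s) / of_nat N))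
     = (\<Sum>s<N. \<Sum>t<N. (\<alpha> s * \<delta> s) * (\<gamma> t * \<beta> t) * (- 1 / of_nat N))"
    by (intro sum.cong refl) simp
  also have "\<dots> = (\<Sum>s<N. \<alpha> s * \<delta> s) * (\<Sum>t<N. \<gamma> t * \<beta> t) * (- 1 / of_nat N)"
    unfolding sum_distrib_right[symmetric] sum_product[symmetric] by (rule refl)
  finally show ?thesis
    unfolding swap using inner by simp
qed

text \<open>For each pair of insertion points the contraction cuts both words there and exchanges
  their tails: the word starting at i now ends at q, and the one starting at p ends at j.\<close>

lemma gam_pow_entry:
  assumes U: "U \<in> carrier_mat N N" and "i < N" "j < N" "p < N" "q < N"
  shows "gam (\<lambda>V. (V ^\<^sub>m k) $$ (i, j)) (\<lambda>V. (V ^\<^sub>m l) $$ (p, q)) U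
    = - (\<Sum>a=1..k. \<Sum>b=1..l. (U ^\<^sub>m (a + (l - b))) $$ (i, q) * (U ^\<^sub>m (b + (k - a))) $$ (p, j)) / of_nat N"
proof -
  let ?d = "\<lambda>X k i j a. \<Sum>s<N. \<Sum>t<N. (U ^\<^sub>m a) $$ (i, s) * X $$ (s, t) * (U ^\<^sub>m (k - a)) $$ (t, j)"
  have d: "lvf N X (\<lambda>V. (V ^\<^sub>m k) $$ (i, j)) U = (\<Sum>a=1..k. ?d X k i j a)"
    if "X \<in> B" "i < N" "j < N" for X i j k
    using lvf_eq_lderiv[OF lderiv_pow_entry[OF B_carrier] U] that by simp
  have "gam (\<lambda>V. (V ^\<^sub>m k) $$ (i, j)) (\<lambda>V. (V ^\<^sub>m l) $$ (p, q)) U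
     = (\<Sum>X\<in>B. \<Sum>a=1..k. \<Sum>b=1..l. ?d X k i j a * ?d X l p q b)"
    unfolding gam_def using assms by (simp add: d sum_product)
  also have "\<dots> = (\<Sum>a=1..k. \<Sum>X\<in>B. \<Sum>b=1..l. ?d X k i j a * ?d X l p q b)"
    by (rule sum.swap)
  also have "\<dots> = (\<Sum>a=1..k. \<Sum>b=1..l. \<Sum>X\<in>B. ?d X k i j a * ?d X l p q b)"
    by (intro sum.cong refl sum.swap)
  also have "\<dots> = (\<Sum>a=1..k. \<Sum>b=1..l.
      - ((U ^\<^sub>m (a + (l - b))) $$ (i, q) * (U ^\<^sub>m (b + (k - a))) $$ (p, j)) / of_nat N)"
    unfolding sum_basis_contraction using assms by (simp add: pow_mat_entry_add)
  finally show ?thesis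
    by (simp add: sum_negf sum_divide_distrib)
qed

text \<open>Closing the second word to a trace joins the two exchanged words into U^(k+l), whatever
  the insertion points, so all k l pairs contribute equally. One factor 1/N comes from the
  contraction, the other from the normalisation of the trace.\<close>

lemma gam_pow_entry_ntr:
  assumes U: "U \<in> carrier_mat N N" and ij: "i < N" "j < N"
  shows "gam (\<lambda>V. (V ^\<^sub>m k) $$ (i, j)) (\<lambda>V. ntr N (V ^\<^sub>m l)) U
    = - (of_nat (k * l) * (U ^\<^sub>m (k + l)) $$ (i, j)) / of_nat N ^ 2"
proof -
  have "(\<Sum>p<N. \<Sum>a=1..k. \<Sum>b=1..l. (U ^\<^sub>m (a + (l - b))) $$ (i, p) * (U ^\<^sub>m (b + (k - a))) $$ (p, j))
      = (\<Sum>a=1..k. \<Sum>b=1..l. \<Sum>p<N. (U ^\<^sub>m (a + (l - b))) $$ (i, p) * (U ^\<^sub>m (b + (k - a))) $$ (p, j))"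
    by (subst sum.swap, intro sum.cong refl sum.swap)
  also have "\<dots> = (\<Sum>a=1..k. \<Sum>b=1..l. (U ^\<^sub>m (k + l)) $$ (i, j))"
    using assms by (intro sum.cong refl) (simp add: pow_mat_entry_add add.commute)
  also have "\<dots> = of_nat (k * l) * (U ^\<^sub>m (k + l)) $$ (i, j)"
    by simp
  finally show ?thesis
    unfolding gam_ntr_right[OF U] using assms
    by (simp add: gam_pow_entry sum_negf sum_divide_distrib[symmetric] power2_eq_square)
qed

lemma gam_ntr_ntr:
  assumes U: "U \<in> carrier_mat N N"
  shows "gam (\<lambda>V. ntr N (V ^\<^sub>m k)) (\<lambda>V. ntr N (V ^\<^sub>m l)) U
    = - (of_nat (k * l) * ntr N (U ^\<^sub>m (k + l))) / of_nat N ^ 2"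
proof -
  have "gam (\<lambda>V. ntr N (V ^\<^sub>m k)) (\<lambda>V. ntr N (V ^\<^sub>m l)) U
      = (\<Sum>p<N. gam (\<lambda>V. (V ^\<^sub>m k) $$ (p, p)) (\<lambda>V. ntr N (V ^\<^sub>m l)) U) / of_nat N"
    using gam_ntr_right[OF U] by (simp add: gam_commute[of _ "\<lambda>V. ntr N (V ^\<^sub>m l)"])
  also have "\<dots> = (\<Sum>p<N. - (of_nat (k * l) * (U ^\<^sub>m (k + l)) $$ (p, p)) / of_nat N ^ 2) / of_nat N"
    using U by (simp add: gam_pow_entry_ntr)
  finally show ?thesis
    by (simp add: ntr_def sum_negf sum_distrib_left sum_divide_distrib mult_ac)
qed

text \<open>The squares of the basis elements sum to minus the identity: each of the N inner indices
  contributes -1/N. The weight N in the inner product is what makes this constant independent of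
  N.\<close>

lemma lap_entry:
  assumes U: "U \<in> carrier_mat N N" and ij: "i < N" "j < N"
  shows "lap (\<lambda>V. V $$ (i, j)) U = - U $$ (i, j)"
proof -
  have "lvf N X (lvf N X (\<lambda>V. V $$ (i, j))) U = (\<Sum>r<N. \<Sum>q<N. U $$ (i, q) * (X $$ (q, r) * X $$ (r, j)))"
    if "X \<in> B" for X
  proof -
    note X = B_carrier[OF that]
    show ?thesis
      using lvf_cong[OF lvf_eq_lderiv[OF lderiv_entry[OF X ij]] U]
        lvf_eq_lderiv[OF lderiv_entry_second[OF X ij] U] by simp
  qed
  then have "lap (\<lambda>V. V $$ (i, j)) U = (\<Sum>X\<in>B. \<Sum>r<N. \<Sum>q<N. U $$ (i, q) * (X $$ (q, r) * X $$ (r, j)))"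
    by (simp add: lap_def)
  also have "\<dots> = (\<Sum>r<N. \<Sum>X\<in>B. \<Sum>q<N. U $$ (i, q) * (X $$ (q, r) * X $$ (r, j)))"
    by (rule sum.swap)
  also have "\<dots> = (\<Sum>r<N. \<Sum>q<N. \<Sum>X\<in>B. U $$ (i, q) * (X $$ (q, r) * X $$ (r, j)))"
    by (intro sum.cong refl sum.swap)
  also have "\<dots> = (\<Sum>r<N. \<Sum>q<N. if q = j then - U $$ (i, j) / of_nat N else 0)"
    unfolding sum_distrib_left[symmetric] using ij
    by (intro sum.cong refl) (simp add: orthonormal_basis_completeness[OF onb])
  also have "\<dots> = - U $$ (i, j)"
    using ij by simp
  finally show ?thesis .
qed

text \<open>In U^(k+1) = U^k U the cross term contracts an insertion in U^k with the one after the
  last letter. It leaves U^a and closes a loop of the other k + 1 - a letters; summing over the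
  middle index r makes that loop a trace.\<close>

lemma lap_pow_entry:
  assumes U: "U \<in> carrier_mat N N"
  shows "i < N \<Longrightarrow> j < N \<Longrightarrow> lap (\<lambda>V. (V ^\<^sub>m k) $$ (i, j)) U
    = - (of_nat k * (U ^\<^sub>m k) $$ (i, j)) - 2 * (\<Sum>m\<in>{1..<k}. of_nat m * (U ^\<^sub>m m) $$ (i, j) * ntr N (U ^\<^sub>m (k - m)))"
proof (induction k arbitrary: i j)
  case 0
  have "lap (\<lambda>V. (V ^\<^sub>m 0) $$ (i, j)) U = lap (\<lambda>V. 1\<^sub>m N $$ (i, j)) U"
    by (rule lap_cong[OF _ U]) auto
  then show ?case using lap_const[OF U] by simp
next
  case (Suc k)
  note ij = Suc.prems
  have "lap (\<lambda>V. (V ^\<^sub>m Suc k) $$ (i, j)) U = lap (\<lambda>V. \<Sum>r<N. (V ^\<^sub>m k) $$ (i, r) * V $$ (r, j)) U"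
    by (rule lap_cong[OF pow_mat_entry_Suc[OF _ ij] U])
  also have "\<dots> = (\<Sum>r<N. lap (\<lambda>V. (V ^\<^sub>m k) $$ (i, r) * V $$ (r, j)) U)"
    using ij by (intro lap_sum twice_lderiv_mult twice_lderiv_pow_entry twice_lderiv_entry U) auto
  also have "\<dots> = (\<Sum>r<N. lap (\<lambda>V. (V ^\<^sub>m k) $$ (i, r)) U * U $$ (r, j) + (U ^\<^sub>m k) $$ (i, r) * lap (\<lambda>V. V $$ (r, j)) U
      + 2 * gam (\<lambda>V. (V ^\<^sub>m k) $$ (i, r)) (\<lambda>V. V $$ (r, j)) U)"
    using ij by (intro sum.cong refl lap_mult twice_lderiv_pow_entry twice_lderiv_entry U) auto
  also have "\<dots> = (\<Sum>r<N. lap (\<lambda>V. (V ^\<^sub>m k) $$ (i, r)) U * U $$ (r, j)) + (\<Sum>r<N. (U ^\<^sub>m k) $$ (i, r) * lap (\<lambda>V. V $$ (r, j)) U)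
      + 2 * (\<Sum>r<N. gam (\<lambda>V. (V ^\<^sub>m k) $$ (i, r)) (\<lambda>V. V $$ (r, j)) U)"
    by (simp add: sum.distrib sum_distrib_left)
  also have "(\<Sum>r<N. (U ^\<^sub>m k) $$ (i, r) * lap (\<lambda>V. V $$ (r, j)) U) = - (U ^\<^sub>m Suc k) $$ (i, j)"
    unfolding pow_mat_entry_Suc[OF U ij] using ij by (simp add: lap_entry[OF U] sum_negf)
  also have "(\<Sum>r<N. gam (\<lambda>V. (V ^\<^sub>m k) $$ (i, r)) (\<lambda>V. V $$ (r, j)) U)
      = - (\<Sum>a=1..k. (U ^\<^sub>m a) $$ (i, j) * ntr N (U ^\<^sub>m (Suc k - a)))"
  proof -
    have "gam (\<lambda>V. (V ^\<^sub>m k) $$ (i, r)) (\<lambda>V. V $$ (r, j)) U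
       = - (\<Sum>a=1..k. (U ^\<^sub>m a) $$ (i, j) * (U ^\<^sub>m (Suc k - a)) $$ (r, r)) / of_nat N" if "r < N" for r
    proof -
      have "gam (\<lambda>V. (V ^\<^sub>m k) $$ (i, r)) (\<lambda>V. V $$ (r, j)) U
          = gam (\<lambda>V. (V ^\<^sub>m k) $$ (i, r)) (\<lambda>V. (V ^\<^sub>m 1) $$ (r, j)) U"
        by (rule gam_cong[OF refl _ U]) simp
      also have "\<dots> = - (\<Sum>a=1..k. (U ^\<^sub>m a) $$ (i, j) * (U ^\<^sub>m (1 + (k - a))) $$ (r, r)) / of_nat N"
        using gam_pow_entry[OF U, of i r r j k 1] ij that by simp
      also have "\<dots> = - (\<Sum>a=1..k. (U ^\<^sub>m a) $$ (i, j) * (U ^\<^sub>m (Suc k - a)) $$ (r, r)) / of_nat N"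
        by (simp add: Suc_diff_le del: pow_mat.simps)
      finally show ?thesis .
    qed
    then have "(\<Sum>r<N. gam (\<lambda>V. (V ^\<^sub>m k) $$ (i, r)) (\<lambda>V. V $$ (r, j)) U)
      = - (\<Sum>r<N. \<Sum>a=1..k. (U ^\<^sub>m a) $$ (i, j) * (U ^\<^sub>m (Suc k - a)) $$ (r, r)) / of_nat N"
      by (simp add: sum_negf sum_divide_distrib[symmetric])
    also have "(\<Sum>r<N. \<Sum>a=1..k. (U ^\<^sub>m a) $$ (i, j) * (U ^\<^sub>m (Suc k - a)) $$ (r, r))
      = (\<Sum>a=1..k. \<Sum>r<N. (U ^\<^sub>m a) $$ (i, j) * (U ^\<^sub>m (Suc k - a)) $$ (r, r))"
      by (rule sum.swap)
    finally show ?thesis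
      by (simp add: ntr_def sum_distrib_left[symmetric] sum_divide_distrib[of _ "{Suc 0..k}"])
  qed
  also have "(\<Sum>r<N. lap (\<lambda>V. (V ^\<^sub>m k) $$ (i, r)) U * U $$ (r, j))
      = - (of_nat k * (U ^\<^sub>m Suc k) $$ (i, j))
        - 2 * (\<Sum>m\<in>{1..<k}. of_nat m * (U ^\<^sub>m Suc m) $$ (i, j) * ntr N (U ^\<^sub>m (k - m)))"
  proof -
    have "(\<Sum>r<N. lap (\<lambda>V. (V ^\<^sub>m k) $$ (i, r)) U * U $$ (r, j))
      = (\<Sum>r<N. - (of_nat k * ((U ^\<^sub>m k) $$ (i, r) * U $$ (r, j)))
          - 2 * (\<Sum>m\<in>{1..<k}. of_nat m * ((U ^\<^sub>m m) $$ (i, r) * U $$ (r, j)) * ntr N (U ^\<^sub>m (k - m))))"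
      using Suc.IH[OF ij(1)]
      by (intro sum.cong refl) (simp add: left_diff_distrib right_diff_distrib sum_distrib_left sum_distrib_right mult_ac)
    also have "\<dots> = - (of_nat k * (\<Sum>r<N. (U ^\<^sub>m k) $$ (i, r) * U $$ (r, j)))
        - 2 * (\<Sum>m\<in>{1..<k}. of_nat m * (\<Sum>r<N. (U ^\<^sub>m m) $$ (i, r) * U $$ (r, j)) * ntr N (U ^\<^sub>m (k - m)))"
      unfolding sum_subtractf sum_negf sum_distrib_left[symmetric]
      by (subst sum.swap) (simp add: sum_distrib_left sum_distrib_right)
    finally show ?thesis
      unfolding pow_mat_entry_Suc[OF U ij] .
  qed
  \<comment> \<open>The last letter has raised the exponent of U by one, so the sum is reindexed.
    The weight at m becomes m - 1, which is 0 for the added summand m = 1, and the cross term raises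
    it back to m.\<close>
  also have "(\<Sum>m\<in>{1..<k}. of_nat m * (U ^\<^sub>m Suc m) $$ (i, j) * ntr N (U ^\<^sub>m (k - m)))
      = (\<Sum>m=1..k. of_nat (m - 1) * (U ^\<^sub>m m) $$ (i, j) * ntr N (U ^\<^sub>m (Suc k - m)))"
  proof -
    have "(\<Sum>m\<in>{1..<k}. of_nat m * (U ^\<^sub>m Suc m) $$ (i, j) * ntr N (U ^\<^sub>m (k - m)))
       = (\<Sum>m\<in>{0..<k}. of_nat m * (U ^\<^sub>m Suc m) $$ (i, j) * ntr N (U ^\<^sub>m (k - m)))"
      by (rule sum.mono_neutral_left) auto
    also have "\<dots> = (\<Sum>m\<in>{Suc 0..<Suc k}. of_nat (m - 1) * (U ^\<^sub>m m) $$ (i, j) * ntr N (U ^\<^sub>m (Suc k - m)))"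
      by (subst sum.shift_bounds_Suc_ivl) (simp del: pow_mat.simps)
    finally show ?thesis by (simp add: atLeastLessThanSuc_atLeastAtMost)
  qed
  also have "- (of_nat k * (U ^\<^sub>m Suc k) $$ (i, j))
        - 2 * (\<Sum>m=1..k. of_nat (m - 1) * (U ^\<^sub>m m) $$ (i, j) * ntr N (U ^\<^sub>m (Suc k - m)))
        + - (U ^\<^sub>m Suc k) $$ (i, j)
        + 2 * - (\<Sum>a=1..k. (U ^\<^sub>m a) $$ (i, j) * ntr N (U ^\<^sub>m (Suc k - a)))
      = - (of_nat (Suc k) * (U ^\<^sub>m Suc k) $$ (i, j))
        - 2 * (\<Sum>m=1..k. of_nat (m - 1) * (U ^\<^sub>m m) $$ (i, j) * ntr N (U ^\<^sub>m (Suc k - m))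
            + (U ^\<^sub>m m) $$ (i, j) * ntr N (U ^\<^sub>m (Suc k - m)))"
    by (simp add: sum.distrib sum_subtractf algebra_simps del: pow_mat.simps)
  also have "(\<Sum>m=1..k. of_nat (m - 1) * (U ^\<^sub>m m) $$ (i, j) * ntr N (U ^\<^sub>m (Suc k - m))
            + (U ^\<^sub>m m) $$ (i, j) * ntr N (U ^\<^sub>m (Suc k - m)))
      = (\<Sum>m\<in>{1..<Suc k}. of_nat m * (U ^\<^sub>m m) $$ (i, j) * ntr N (U ^\<^sub>m (Suc k - m)))"
    by (intro sum.cong) (auto simp: of_nat_diff algebra_simps simp del: pow_mat.simps)
  finally show ?case .
qed

text \<open>This is the normalised trace of the formula for U^k, which explains why the prescribed
  value at v_k is that at u^k with every u^m replaced by v_m.\<close>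

lemma lap_ntr_pow:
  assumes U: "U \<in> carrier_mat N N"
  shows "lap (\<lambda>V. ntr N (V ^\<^sub>m k)) U
    = - (of_nat k * ntr N (U ^\<^sub>m k)) - 2 * (\<Sum>m\<in>{1..<k}. of_nat m * ntr N (U ^\<^sub>m m) * ntr N (U ^\<^sub>m (k - m)))"
proof -
  have "lap (\<lambda>V. ntr N (V ^\<^sub>m k)) U = lap (\<lambda>V. 1 / of_nat N * (\<Sum>i<N. (V ^\<^sub>m k) $$ (i, i))) U"
    by (simp add: ntr_def)
  also have "\<dots> = 1 / of_nat N * (\<Sum>i<N. lap (\<lambda>V. (V ^\<^sub>m k) $$ (i, i)) U)"
    by (subst lap_cmult; (subst lap_sum)?; auto intro!: U twice_lderiv_sum twice_lderiv_pow_entry)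
  also have "(\<Sum>i<N. lap (\<lambda>V. (V ^\<^sub>m k) $$ (i, i)) U)
      = - (of_nat k * (\<Sum>i<N. (U ^\<^sub>m k) $$ (i, i)))
        - 2 * (\<Sum>m\<in>{1..<k}. of_nat m * (\<Sum>i<N. (U ^\<^sub>m m) $$ (i, i)) * ntr N (U ^\<^sub>m (k - m)))"
    by (simp add: lap_pow_entry[OF U] sum_subtractf sum_negf sum_distrib_left[symmetric] sum_distrib_right)
      (subst sum.swap, simp add: sum_distrib_left sum_distrib_right)
  finally show ?thesis
    by (simp add: ntr_def diff_divide_distrib sum_divide_distrib[of _ "{Suc 0..<k}"]
        sum_distrib_left[of _ _ "{Suc 0..<k}"] field_simps)
qed

end

section \<open>Operators on polynomials\<close>

abbreviation mon :: "(nat \<Rightarrow>\<^sub>0 nat) \<Rightarrow> cpoly" where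
  "mon m \<equiv> Poly_Mapping.single m 1"

lemma csmult_eq_mult: "csmult c p = Poly_Mapping.single 0 c * p"
  unfolding csmult_def by (rule mult_map_scale_conv_mult)

lemma csmult_zero: "csmult 0 p = 0"
  by (simp add: csmult_eq_mult)

lemma csmult_mult_left: "csmult c p * q = csmult c (p * q)"
  by (simp add: csmult_eq_mult mult.assoc)

lemma csmult_add: "csmult c (p + q) = csmult c p + csmult c q"
  by (simp add: csmult_eq_mult distrib_left)

lemma csmult_mon: "csmult c (mon m) = Poly_Mapping.single m c"
  by (simp add: csmult_eq_mult mult_single)

lemma mon_add: "mon (m + n) = mon m * mon n"
  by (simp add: mult_single)

lemma var_u_power: "var_u ^ k = mon (Poly_Mapping.single 0 k)"
  by (induction k) (simp_all add: var_u_def mult_single single_add[symmetric])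

lemma poly_sum_monomials:
  fixes p :: "'a \<Rightarrow>\<^sub>0 'b::comm_monoid_add"
  shows "p = (\<Sum>m\<in>Poly_Mapping.keys p. Poly_Mapping.single m (Poly_Mapping.lookup p m))"
proof (rule poly_mapping_eqI)
  fix k
  have "Poly_Mapping.lookup (\<Sum>m\<in>Poly_Mapping.keys p. Poly_Mapping.single m (Poly_Mapping.lookup p m)) k
      = (\<Sum>m\<in>Poly_Mapping.keys p. if m = k then Poly_Mapping.lookup p m else 0)"
    unfolding lookup_sum by (intro sum.cong) (auto simp: lookup_single)
  then show "Poly_Mapping.lookup p k = Poly_Mapping.lookup (\<Sum>m\<in>Poly_Mapping.keys p. Poly_Mapping.single m (Poly_Mapping.lookup p m)) k"
    by (simp add: in_keys_iff)
qed

lemma linear_op_add: "is_linear_op T \<Longrightarrow> T (p + q) = T p + T q"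
  by (simp add: is_linear_op_def)

lemma linear_op_csmult: "is_linear_op T \<Longrightarrow> T (csmult c p) = csmult c (T p)"
  by (simp add: is_linear_op_def)

lemma linear_op_zero: "is_linear_op T \<Longrightarrow> T 0 = 0"
  using linear_op_csmult[of T 0 0] by (simp add: csmult_eq_mult)

lemma linear_op_sum:
  assumes "is_linear_op T"
  shows "T (sum f A) = (\<Sum>a\<in>A. T (f a))"
  by (induction A rule: infinite_finite_induct)
    (simp_all add: linear_op_zero[OF assms] linear_op_add[OF assms])

lemma linear_op_expand:
  assumes "is_linear_op T"
  shows "T p = (\<Sum>m\<in>Poly_Mapping.keys p. csmult (Poly_Mapping.lookup p m) (T (mon m)))"
proof -
  have "T p = T (\<Sum>m\<in>Poly_Mapping.keys p. csmult (Poly_Mapping.lookup p m) (mon m))"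
    using poly_sum_monomials[of p] by (simp add: csmult_mon)
  then show ?thesis
    by (simp add: linear_op_sum[OF assms] linear_op_csmult[OF assms])
qed

lemma linear_op_eqI:
  assumes "is_linear_op S" "is_linear_op T" "\<And>m. S (mon m) = T (mon m)"
  shows "S = T"
  by (rule ext, subst linear_op_expand[OF assms(1)], subst linear_op_expand[OF assms(2)], subst assms(3), rule refl)

definition lin_ext :: "((nat \<Rightarrow>\<^sub>0 nat) \<Rightarrow> cpoly) \<Rightarrow> cpoly \<Rightarrow> cpoly" where
  "lin_ext F p = (\<Sum>m\<in>Poly_Mapping.keys p. csmult (Poly_Mapping.lookup p m) (F m))"

lemma lin_ext_mon: "lin_ext F (mon m) = F m"
  by (simp add: lin_ext_def csmult_eq_mult)

text \<open>Keys can disappear, for instance under scaling by 0. Summands that vanish at coefficient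
  0 allow the index set to be held fixed.\<close>

lemma sum_keys_superset:
  assumes "finite A" "Poly_Mapping.keys p \<subseteq> A" "\<And>m. f m 0 = 0"
  shows "(\<Sum>m\<in>Poly_Mapping.keys p. f m (Poly_Mapping.lookup p m)) = (\<Sum>m\<in>A. f m (Poly_Mapping.lookup p m))"
  using assms by (intro sum.mono_neutral_left) (auto simp: in_keys_iff)

lemma lookup_csmult: "Poly_Mapping.lookup (csmult c p) m = c * Poly_Mapping.lookup p m"
  unfolding csmult_def by (simp add: Poly_Mapping.map.rep_eq when_def)

lemma keys_csmult: "Poly_Mapping.keys (csmult c p) \<subseteq> Poly_Mapping.keys p"
  by (auto simp: in_keys_iff lookup_csmult)

lemma lin_ext_linear: "is_linear_op (lin_ext F)"
  unfolding is_linear_op_def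
proof (intro conjI allI)
  fix p q
  show "lin_ext F (p + q) = lin_ext F p + lin_ext F q"
    unfolding lin_ext_def
    by (rule setsum_keys_plus_distrib) (simp_all add: csmult_eq_mult single_add distrib_right)
next
  fix c p
  have "lin_ext F (csmult c p) = (\<Sum>m\<in>Poly_Mapping.keys p. csmult (c * Poly_Mapping.lookup p m) (F m))"
    unfolding lin_ext_def
    by (subst sum_keys_superset[OF _ keys_csmult, where f = "\<lambda>m x. csmult x (F m)"])
      (simp_all add: lookup_csmult csmult_zero)
  also have "\<dots> = csmult c (lin_ext F p)"
    unfolding lin_ext_def csmult_eq_mult sum_distrib_left
    by (simp add: mult.assoc[symmetric] mult_single)
  finally show "lin_ext F (csmult c p) = csmult c (lin_ext F p)" .
qed

text \<open>All pure powers of u are base cases, because no product rule relates them to each other.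
  Stripping off one v_k lowers the total degree in the v variables, which is the induction
  measure.\<close>

lemma monomial_induct [case_names power_u times_v]:
  fixes m :: "nat \<Rightarrow>\<^sub>0 nat"
  assumes u: "\<And>k. P (Poly_Mapping.single 0 k)"
    and v: "\<And>m k. P m \<Longrightarrow> 1 \<le> k \<Longrightarrow> P (m + Poly_Mapping.single k 1)"
  shows "P m"
proof (induction "\<Sum>k\<in>Poly_Mapping.keys m - {0}. Poly_Mapping.lookup m k" arbitrary: m rule: less_induct)
  case less
  show ?case
  proof (cases "Poly_Mapping.keys m \<subseteq> {0}")
    case True
    have "m = Poly_Mapping.single 0 (Poly_Mapping.lookup m 0)"
      using True by (intro poly_mapping_eqI) (auto simp: lookup_single when_def in_keys_iff)
    then show ?thesis using u by metis
  next
    case False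
    then obtain k where k: "k \<in> Poly_Mapping.keys m" "k \<noteq> 0" by auto
    \<comment> \<open>The truncated subtraction is exact, since k is a key of m and so has a
      positive exponent.\<close>
    define n where "n = m - Poly_Mapping.single k 1"
    have m: "m = n + Poly_Mapping.single k 1"
      using k by (intro poly_mapping_eqI) (auto simp: n_def lookup_add lookup_minus lookup_single when_def in_keys_iff)
    have ln: "Poly_Mapping.lookup n l = Poly_Mapping.lookup m l - (if l = k then 1 else 0)" for l
      by (simp add: n_def lookup_minus lookup_single when_def)
    have "Poly_Mapping.keys n \<subseteq> Poly_Mapping.keys m" by (auto simp: in_keys_iff ln)
    then have "(\<Sum>l\<in>Poly_Mapping.keys n - {0}. Poly_Mapping.lookup n l) = (\<Sum>l\<in>Poly_Mapping.keys m - {0}. Poly_Mapping.lookup n l)"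
      by (intro sum.mono_neutral_left) (auto simp: in_keys_iff)
    also have "\<dots> < (\<Sum>l\<in>Poly_Mapping.keys m - {0}. Poly_Mapping.lookup m l)"
      using k by (intro sum_strict_mono_ex1) (auto simp: ln in_keys_iff intro!: bexI[of _ k])
    finally have "P n" using less by blast
    then show ?thesis using v[of n k] k m by simp
  qed
qed

section \<open>The operator D: uniqueness and construction\<close>

lemma var_v_scalar: "1 \<le> k \<Longrightarrow> is_scalar (var_v k)"
  by (simp add: is_scalar_def var_v_def lookup_single)

definition D_u :: "nat \<Rightarrow> cpoly" where
  "D_u k = - (of_nat k * var_u ^ k) - 2 * (\<Sum>m\<in>{1..<k}. of_nat m * var_u ^ m * var_v (k - m))"

definition D_v :: "nat \<Rightarrow> cpoly" where
  "D_v k = - (of_nat k * var_v k) - 2 * (\<Sum>m\<in>{1..<k}. of_nat m * var_v m * var_v (k - m))"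

lemma D_conditions_iff:
  "D_conditions R \<longleftrightarrow> (\<forall>k\<ge>1. R (var_u ^ k) = D_u k) \<and> (\<forall>k\<ge>1. R (var_v k) = D_v k)
    \<and> (\<forall>p q. is_scalar p \<or> is_scalar q \<longrightarrow> R (p * q) = R p * q + p * R q)"
  unfolding D_conditions_def D_u_def D_v_def by (rule refl)

text \<open>The conditions reach every monomial: its power of u is prescribed, and each further
  factor is a scalar v_k with prescribed value, to which the product rule applies.\<close>

lemma D_conditions_unique:
  assumes S: "is_linear_op S" "D_conditions S" and T: "is_linear_op T" "D_conditions T"
  shows "S = T"
proof (rule linear_op_eqI[OF S(1) T(1)])
  \<comment> \<open>The prescribed powers of u start at k = 1; the value at the constant 1 comes
    from the product rule for 1 * 1.\<close>
  have one: "R 1 = 0" if "D_conditions R" for R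
  proof -
    have "is_scalar 1" by (simp add: is_scalar_def)
    then have "R (1 * 1) = R 1 * 1 + 1 * R 1" using that unfolding D_conditions_iff by blast
    then show ?thesis by simp
  qed
  have step: "R (mon (m + Poly_Mapping.single k 1)) = R (mon m) * var_v k + mon m * R (var_v k)"
    if "D_conditions R" "1 \<le> k" for R m k
    using that var_v_scalar[of k] unfolding D_conditions_iff mon_add var_v_def[symmetric] by blast
  fix m
  show "S (mon m) = T (mon m)"
  proof (induction m rule: monomial_induct)
    case (power_u k)
    show ?case
    proof (cases "k = 0")
      case True
      then show ?thesis using one[OF S(2)] one[OF T(2)] by simp
    next
      case False
      then have "S (var_u ^ k) = T (var_u ^ k)"
        using S(2) T(2) unfolding D_conditions_iff by simp
      then show ?thesis by (simp add: var_u_power)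
    qed
  next
    case (times_v m k)
    have "S (var_v k) = T (var_v k)"
      using S(2) T(2) times_v(2) unfolding D_conditions_iff by simp
    then show ?case
      unfolding step[OF S(2) times_v(2)] step[OF T(2) times_v(2)] using times_v(1) by simp
  qed
qed

text \<open>Not a derivation, since \<open>D_u\<close> is not: the power of \<open>u\<close> is split off as a whole, and the
  derivation with \<open>v\<^sub>k \<mapsto> D_v k\<close> acts on the rest.\<close>

definition D_mon :: "(nat \<Rightarrow>\<^sub>0 nat) \<Rightarrow> cpoly" where
  "D_mon m = D_u (Poly_Mapping.lookup m 0) * mon (m - Poly_Mapping.single 0 (Poly_Mapping.lookup m 0))
    + (\<Sum>k\<in>Poly_Mapping.keys m - {0}. of_nat (Poly_Mapping.lookup m k) * mon (m - Poly_Mapping.single k 1) * D_v k)"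

lemma D_mon_power_u: "D_mon (Poly_Mapping.single 0 k) = D_u k"
  by (simp add: D_mon_def)

text \<open>At k = 0, outside the prescribed range, the formula still yields the value that the
  product rule forces on 1, so \<open>D_mon\<close> needs no case distinction for monomials free of
  u.\<close>

lemma D_u_zero: "D_u 0 = 0"
  by (simp add: D_u_def)

lemma D_mon_var_v: "1 \<le> k \<Longrightarrow> D_mon (Poly_Mapping.single k 1) = D_v k"
  by (simp add: D_mon_def lookup_single D_u_zero)

text \<open>The supports of m, n and m + n differ; a common index set makes the three sums
  comparable term by term.\<close>

lemma D_mon_superset:
  assumes "finite A" "Poly_Mapping.keys m - {0} \<subseteq> A"
  shows "D_mon m = D_u (Poly_Mapping.lookup m 0) * mon (m - Poly_Mapping.single 0 (Poly_Mapping.lookup m 0))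
    + (\<Sum>k\<in>A - {0}. of_nat (Poly_Mapping.lookup m k) * mon (m - Poly_Mapping.single k 1) * D_v k)"
  unfolding D_mon_def
  using assms by (intro arg_cong2[where f = "(+)"] refl sum.mono_neutral_left) (auto simp: in_keys_iff)

text \<open>Truncated subtraction of one v_k may be moved into the factor m only if its exponent
  there is positive; in the remaining case the coefficient is 0.\<close>

lemma of_nat_mon_minus:
  "of_nat (Poly_Mapping.lookup m k) * mon (m + n - Poly_Mapping.single k 1)
    = of_nat (Poly_Mapping.lookup m k) * (mon (m - Poly_Mapping.single k 1) * mon n)"
proof (cases "Poly_Mapping.lookup m k = 0")
  case False
  then have "m + n - Poly_Mapping.single k 1 = m - Poly_Mapping.single k 1 + n"
    by (intro poly_mapping_eqI) (auto simp: lookup_add lookup_minus lookup_single when_def)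
  then show ?thesis by (simp add: mon_add)
qed simp

text \<open>As n is free of u, the block of u in m + n is the block of m, and the u-term of
  \<open>D_mon n\<close> is \<open>D_u 0\<close>, which vanishes. What remains is the Leibniz rule
  for a derivation in the v variables.\<close>

lemma D_mon_mult:
  assumes n: "Poly_Mapping.lookup n 0 = 0"
  shows "D_mon (m + n) = D_mon m * mon n + mon m * D_mon n"
proof -
  let ?A = "Poly_Mapping.keys m \<union> Poly_Mapping.keys n"
  have k: "Poly_Mapping.keys (m + n) - {0} \<subseteq> ?A" "Poly_Mapping.keys m - {0} \<subseteq> ?A" "Poly_Mapping.keys n - {0} \<subseteq> ?A"
    by (auto simp: in_keys_iff lookup_add)
  have "m + n - Poly_Mapping.single 0 (Poly_Mapping.lookup m 0) = m - Poly_Mapping.single 0 (Poly_Mapping.lookup m 0) + n"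
    by (intro poly_mapping_eqI) (simp add: lookup_add lookup_minus lookup_single when_def)
  then have u: "mon (m + n - Poly_Mapping.single 0 (Poly_Mapping.lookup m 0)) = mon (m - Poly_Mapping.single 0 (Poly_Mapping.lookup m 0)) * mon n"
    by (simp add: mon_add)
  have "of_nat (Poly_Mapping.lookup (m + n) k) * mon (m + n - Poly_Mapping.single k 1) * D_v k
     = of_nat (Poly_Mapping.lookup m k) * mon (m - Poly_Mapping.single k 1) * D_v k * mon n
       + mon m * (of_nat (Poly_Mapping.lookup n k) * mon (n - Poly_Mapping.single k 1) * D_v k)" for k
  proof -
    have "of_nat (Poly_Mapping.lookup (m + n) k) * mon (m + n - Poly_Mapping.single k 1)
       = of_nat (Poly_Mapping.lookup m k) * mon (m + n - Poly_Mapping.single k 1)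
         + of_nat (Poly_Mapping.lookup n k) * mon (n + m - Poly_Mapping.single k 1)"
      by (simp add: lookup_add distrib_right add.commute[of n m])
    then show ?thesis
      unfolding of_nat_mon_minus by (simp add: algebra_simps)
  qed
  then have v: "(\<Sum>k\<in>?A - {0}. of_nat (Poly_Mapping.lookup (m + n) k) * mon (m + n - Poly_Mapping.single k 1) * D_v k)
     = (\<Sum>k\<in>?A - {0}. of_nat (Poly_Mapping.lookup m k) * mon (m - Poly_Mapping.single k 1) * D_v k) * mon n
       + mon m * (\<Sum>k\<in>?A - {0}. of_nat (Poly_Mapping.lookup n k) * mon (n - Poly_Mapping.single k 1) * D_v k)"
    by (simp only: sum.distrib sum_distrib_left sum_distrib_right)
  show ?thesis
    unfolding D_mon_superset[OF _ k(1), simplified] D_mon_superset[OF _ k(2), simplified]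
      D_mon_superset[OF _ k(3), simplified]
    using u v n by (simp add: lookup_add D_u_zero algebra_simps)
qed

lemma D_ext_conditions: "D_conditions (lin_ext D_mon)"
proof -
  let ?D = "lin_ext D_mon"
  have leib: "?D (p * q) = ?D p * q + p * ?D q" if q: "is_scalar q" for p q
  proof -
    \<comment> \<open>For fixed scalar q both sides of the product rule are linear in p, so it
      suffices to compare them on monomials; q is then expanded into its own monomials, all free of
      u.\<close>
    define S where "S p = ?D (p * q)" for p
    define T where "T p = ?D p * q + p * ?D q" for p
    have "is_linear_op S" "is_linear_op T"
      using linear_op_add[OF lin_ext_linear[of D_mon]] linear_op_csmult[OF lin_ext_linear[of D_mon]]
      by (simp_all add: is_linear_op_def S_def T_def csmult_mult_left csmult_add distrib_right)
    moreover have "S (mon m) = T (mon m)" for m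
    proof -
      have "mon m * q = (\<Sum>n\<in>Poly_Mapping.keys q. csmult (Poly_Mapping.lookup q n) (mon (m + n)))"
        by (subst (1) poly_sum_monomials[of q]) (simp add: csmult_mon sum_distrib_left mult_single)
      then have "S (mon m) = ?D (\<Sum>n\<in>Poly_Mapping.keys q. csmult (Poly_Mapping.lookup q n) (mon (m + n)))"
        by (simp add: S_def)
      also have "\<dots> = (\<Sum>n\<in>Poly_Mapping.keys q. csmult (Poly_Mapping.lookup q n) (D_mon (m + n)))"
        by (simp add: linear_op_sum[OF lin_ext_linear] linear_op_csmult[OF lin_ext_linear] lin_ext_mon)
      also have "\<dots> = (\<Sum>n\<in>Poly_Mapping.keys q. D_mon m * csmult (Poly_Mapping.lookup q n) (mon n) + mon m * csmult (Poly_Mapping.lookup q n) (D_mon n))"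
        using q by (intro sum.cong refl) (simp add: D_mon_mult is_scalar_def csmult_eq_mult distrib_left mult_ac)
      also have "\<dots> = D_mon m * (\<Sum>n\<in>Poly_Mapping.keys q. csmult (Poly_Mapping.lookup q n) (mon n)) + mon m * lin_ext D_mon q"
        by (simp add: sum.distrib sum_distrib_left lin_ext_def)
      also have "(\<Sum>n\<in>Poly_Mapping.keys q. csmult (Poly_Mapping.lookup q n) (mon n)) = q"
        using poly_sum_monomials[of q] by (simp add: csmult_mon)
      finally show ?thesis by (simp add: T_def lin_ext_mon)
    qed
    ultimately have "S = T" by (rule linear_op_eqI)
    then show ?thesis unfolding S_def T_def by metis
  qed
  have "?D (p * q) = ?D p * q + p * ?D q" if "is_scalar p" for p q
    using leib[OF that, of q] by (simp add: algebra_simps)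
  then show ?thesis
    unfolding D_conditions_iff using leib D_mon_power_u D_mon_var_v
    by (auto simp: var_u_power lin_ext_mon var_v_def)
qed

section \<open>Evaluation of polynomials at matrices\<close>

text \<open>With i and j fixed this is a scalar function of U, so the scalar calculus of
  \<open>lap\<close> and \<open>gam\<close> applies and no matrix-valued product rule is
  required.\<close>

definition mon_eval :: "nat \<Rightarrow> (nat \<Rightarrow>\<^sub>0 nat) \<Rightarrow> nat \<Rightarrow> nat \<Rightarrow> complex mat \<Rightarrow> complex" where
  "mon_eval N m i j U = (\<Prod>k\<in>Poly_Mapping.keys m - {0}. ntr N (U ^\<^sub>m k) ^ Poly_Mapping.lookup m k)
     * (U ^\<^sub>m Poly_Mapping.lookup m 0) $$ (i, j)"

definition entry_eval :: "nat \<Rightarrow> cpoly \<Rightarrow> nat \<Rightarrow> nat \<Rightarrow> complex mat \<Rightarrow> complex" where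
  "entry_eval N p i j U = (\<Sum>m\<in>Poly_Mapping.keys p. Poly_Mapping.lookup p m * mon_eval N m i j U)"

lemma eval_N_entry: "eval_N N p U = mat N N (\<lambda>(i, j). entry_eval N p i j U)"
  by (simp add: eval_N_def entry_eval_def mon_eval_def mult.assoc)

lemma twice_lderiv_mon_eval:
  "i < N \<Longrightarrow> j < N \<Longrightarrow> twice_lderiv N (mon_eval N m i j)"
  unfolding mon_eval_def
  by (intro twice_lderiv_mult twice_lderiv_prod twice_lderiv_power twice_lderiv_ntr_pow twice_lderiv_pow_entry)

lemma mon_eval_power_u: "mon_eval N (Poly_Mapping.single 0 k) i j U = (U ^\<^sub>m k) $$ (i, j)"
  by (simp add: mon_eval_def)

lemma mon_eval_times_v:
  assumes k: "1 \<le> k"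
  shows "mon_eval N (m + Poly_Mapping.single k 1) i j U = mon_eval N m i j U * ntr N (U ^\<^sub>m k)"
proof -
  \<comment> \<open>A common index set for both products. If k is new, its factor in the old product
    is a zeroth power; since k is positive, removing 0 does not remove it.\<close>
  let ?A = "insert k (Poly_Mapping.keys m) - {0}"
  let ?t = "\<lambda>l. ntr N (U ^\<^sub>m l)"
  define n where "n = m + Poly_Mapping.single k 1"
  have n: "Poly_Mapping.lookup n l = Poly_Mapping.lookup m l + (if l = k then 1 else 0)" for l
    by (simp add: n_def lookup_add lookup_single when_def)
  have "(\<Prod>l\<in>Poly_Mapping.keys n - {0}. ?t l ^ Poly_Mapping.lookup n l) = (\<Prod>l\<in>?A. ?t l ^ Poly_Mapping.lookup n l)"
    by (rule prod.mono_neutral_left) (auto simp: in_keys_iff n split: if_splits)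
  also have "\<dots> = (\<Prod>l\<in>?A. ?t l ^ Poly_Mapping.lookup m l) * (\<Prod>l\<in>?A. if l = k then ?t l else 1)"
    unfolding prod.distrib[symmetric] by (rule prod.cong) (simp_all add: n)
  also have "(\<Prod>l\<in>?A. ?t l ^ Poly_Mapping.lookup m l) = (\<Prod>l\<in>Poly_Mapping.keys m - {0}. ?t l ^ Poly_Mapping.lookup m l)"
    by (rule prod.mono_neutral_right) (auto simp: in_keys_iff intro!: Nat.gr0I)
  also have "(\<Prod>l\<in>?A. if l = k then ?t l else 1) = ?t k"
    using k by simp
  finally show ?thesis
    using k by (simp add: mon_eval_def n n_def[symmetric] del: One_nat_def)
qed

lemma entry_eval_add: "entry_eval N (p + q) i j U = entry_eval N p i j U + entry_eval N q i j U"
  unfolding entry_eval_def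
  by (rule setsum_keys_plus_distrib[where f = "\<lambda>m x. x * mon_eval N m i j U"]) (simp_all add: distrib_right)

lemma entry_eval_csmult: "entry_eval N (csmult c p) i j U = c * entry_eval N p i j U"
  unfolding entry_eval_def
  by (subst sum_keys_superset[OF _ keys_csmult, where f = "\<lambda>m x. x * mon_eval N m i j U"])
    (simp_all add: lookup_csmult sum_distrib_left mult.assoc)

lemma entry_eval_zero: "entry_eval N 0 i j U = 0"
  by (simp add: entry_eval_def)

lemma entry_eval_uminus: "entry_eval N (- p) i j U = - entry_eval N p i j U"
  using entry_eval_add[of N p "- p" i j U] by (simp add: entry_eval_zero add_eq_0_iff)

lemma entry_eval_diff: "entry_eval N (p - q) i j U = entry_eval N p i j U - entry_eval N q i j U"
  using entry_eval_add[of N p "- q" i j U] by (simp add: entry_eval_uminus)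

lemma entry_eval_sum: "entry_eval N (sum f A) i j U = (\<Sum>a\<in>A. entry_eval N (f a) i j U)"
  by (induction A rule: infinite_finite_induct) (simp_all add: entry_eval_zero entry_eval_add)

lemma entry_eval_of_nat: "entry_eval N (of_nat n * p) i j U = of_nat n * entry_eval N p i j U"
  using entry_eval_csmult[of N "of_nat n" p i j U] by (simp add: csmult_eq_mult)

lemma entry_eval_numeral: "entry_eval N (numeral n * p) i j U = numeral n * entry_eval N p i j U"
  using entry_eval_of_nat[of N "numeral n" p i j U] by simp

lemma entry_eval_mon: "entry_eval N (mon m) i j U = mon_eval N m i j U"
  by (simp add: entry_eval_def)

text \<open>An entry of a matrix product is not the product of the entries, so evaluation at fixed
  indices is not multiplicative. It is so for the factor v_k, which evaluates to a scalar
  matrix.\<close>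

lemma entry_eval_times_v:
  assumes "1 \<le> k"
  shows "entry_eval N (p * var_v k) i j U = entry_eval N p i j U * ntr N (U ^\<^sub>m k)"
proof -
  have "p * var_v k = (\<Sum>m\<in>Poly_Mapping.keys p. csmult (Poly_Mapping.lookup p m) (mon (m + Poly_Mapping.single k 1)))"
    by (subst (1) poly_sum_monomials[of p]) (simp add: csmult_mon sum_distrib_right var_v_def mult_single)
  then have "entry_eval N (p * var_v k) i j U
      = (\<Sum>m\<in>Poly_Mapping.keys p. Poly_Mapping.lookup p m * (mon_eval N m i j U * ntr N (U ^\<^sub>m k)))"
    using assms by (simp add: entry_eval_sum entry_eval_csmult entry_eval_mon mon_eval_times_v del: One_nat_def)
  then show ?thesis
    by (simp add: entry_eval_def sum_distrib_right mult.assoc)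
qed

lemma entry_eval_D_u:
  "entry_eval N (D_u k) i j U = - (of_nat k * (U ^\<^sub>m k) $$ (i, j))
    - 2 * (\<Sum>m\<in>{1..<k}. of_nat m * (U ^\<^sub>m m) $$ (i, j) * ntr N (U ^\<^sub>m (k - m)))"
proof -
  have "entry_eval N (of_nat m * var_u ^ m * var_v (k - m)) i j U
      = of_nat m * (U ^\<^sub>m m) $$ (i, j) * ntr N (U ^\<^sub>m (k - m))" if "m \<in> {1..<k}" for m
  proof -
    have "1 \<le> k - m" using that by auto
    then show ?thesis
      by (simp add: entry_eval_times_v entry_eval_of_nat var_u_power entry_eval_mon mon_eval_power_u)
  qed
  then show ?thesis
    by (simp add: D_u_def entry_eval_diff entry_eval_uminus entry_eval_of_nat entry_eval_numeral
        entry_eval_sum var_u_power entry_eval_mon mon_eval_power_u)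
qed

lemma entry_eval_times_D_v:
  assumes k: "1 \<le> k"
  shows "entry_eval N (p * D_v k) i j U = entry_eval N p i j U * (- (of_nat k * ntr N (U ^\<^sub>m k))
    - 2 * (\<Sum>m\<in>{1..<k}. of_nat m * ntr N (U ^\<^sub>m m) * ntr N (U ^\<^sub>m (k - m))))"
proof -
  \<comment> \<open>Every v is made a right-hand factor, the position in which evaluation is
    multiplicative.\<close>
  have 1: "p * D_v k = - (of_nat k * (p * var_v k)) - 2 * (\<Sum>m\<in>{1..<k}. of_nat m * (p * var_v m * var_v (k - m)))"
    by (simp add: D_v_def right_diff_distrib sum_distrib_left mult_ac)
  have "entry_eval N (of_nat m * (p * var_v m * var_v (k - m))) i j U
      = entry_eval N p i j U * (of_nat m * ntr N (U ^\<^sub>m m) * ntr N (U ^\<^sub>m (k - m)))" if "m \<in> {1..<k}" for m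
  proof -
    have "1 \<le> m" "1 \<le> k - m" using that by auto
    then show ?thesis by (simp add: entry_eval_times_v entry_eval_of_nat)
  qed
  then show ?thesis
    unfolding 1 entry_eval_diff entry_eval_uminus entry_eval_numeral entry_eval_sum
      entry_eval_of_nat[of N k] entry_eval_times_v[OF k]
    by (simp add: right_diff_distrib sum_distrib_left[symmetric])
qed

text \<open>\<open>R\<close> is quantified before N, so it depends only on m and l. As
  \<open>gam\<close> is a derivation in each argument and yields 1/N^2 against a trace for powers of
  U and for traces alike, this order persists for all monomials.\<close>

lemma gam_mon_eval_ntr:
  "\<exists>R. \<forall>N B U i j. onb_u N B \<longrightarrow> U \<in> carrier_mat N N \<longrightarrow> i < N \<longrightarrow> j < N \<longrightarrow>
     onb_u.gam N B (mon_eval N m i j) (\<lambda>V. ntr N (V ^\<^sub>m l)) U = - entry_eval N R i j U / of_nat N ^ 2"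
proof (induction m rule: monomial_induct)
  case (power_u k)
  show ?case
  proof (intro exI allI impI)
    fix N :: nat and B and U :: "complex mat" and i j assume "onb_u N B" and a: "U \<in> carrier_mat N N" "i < N" "j < N"
    then interpret onb_u N B by simp
    show "gam (mon_eval N (Poly_Mapping.single 0 k) i j) (\<lambda>V. ntr N (V ^\<^sub>m l)) U
      = - entry_eval N (of_nat (k * l) * mon (Poly_Mapping.single 0 (k + l))) i j U / of_nat N ^ 2"
      using gam_pow_entry_ntr[OF a, of k l]
      unfolding entry_eval_of_nat entry_eval_mon mon_eval_power_u by (simp add: mon_eval_power_u[abs_def])
  qed
next
  case (times_v m k)
  then obtain R where R: "\<And>N B U i j. onb_u N B \<Longrightarrow> U \<in> carrier_mat N N \<Longrightarrow> i < N \<Longrightarrow> j < N \<Longrightarrow>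
     onb_u.gam N B (mon_eval N m i j) (\<lambda>V. ntr N (V ^\<^sub>m l)) U = - entry_eval N R i j U / of_nat N ^ 2"
    by blast
  show ?case
  \<comment> \<open>The witness stays schematic until the closing \<open>show\<close>. Of its two
    summands, \<open>R * var_v k\<close> comes from the old monomial and the other from the new
    factor tr (U^k).\<close>
  proof (intro exI allI impI)
    fix N :: nat and B and U :: "complex mat" and i j assume loc: "onb_u N B" and a: "U \<in> carrier_mat N N" "i < N" "j < N"
    then interpret onb_u N B by simp
    let ?t = "\<lambda>k V. ntr N (V ^\<^sub>m k)"
    have "gam (mon_eval N (m + Poly_Mapping.single k 1) i j) (?t l) U
        = gam (?t l) (\<lambda>V. mon_eval N m i j V * ?t k V) U"
      unfolding mon_eval_times_v[OF times_v(2), abs_def] by (rule gam_commute)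
    also have "\<dots> = gam (?t l) (mon_eval N m i j) U * ?t k U + mon_eval N m i j U * gam (?t l) (?t k) U"
      using a by (intro gam_mult_right twice_lderiv_mon_eval twice_lderiv_ntr_pow)
    also have "gam (?t l) (mon_eval N m i j) U = - entry_eval N R i j U / of_nat N ^ 2"
      using R[OF loc a] by (simp add: gam_commute)
    also have "gam (?t l) (?t k) U = - (of_nat (l * k) * ntr N (U ^\<^sub>m (l + k))) / of_nat N ^ 2"
      by (rule gam_ntr_ntr[OF a(1)])
    also have "- entry_eval N R i j U / of_nat N ^ 2 * ?t k U
        + mon_eval N m i j U * (- (of_nat (l * k) * ntr N (U ^\<^sub>m (l + k))) / of_nat N ^ 2)
      = - entry_eval N (R * var_v k + of_nat (l * k) * (mon m * var_v (l + k))) i j U / of_nat N ^ 2"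
      using times_v(2)
      by (simp add: entry_eval_add entry_eval_of_nat[of N "l * k"] entry_eval_times_v entry_eval_mon
          add_divide_distrib diff_divide_distrib del: of_nat_mult)
    finally show "gam (mon_eval N (m + Poly_Mapping.single k 1) i j) (?t l) U = \<dots>" .
  qed
qed

text \<open>The order-one part must be \<open>D_mon m\<close> itself, the operator already known to
  satisfy the conditions. The correction starts at 0 for powers of u, and a factor v_k changes it
  from Q to Q v_k + 2 R, where R describes \<open>gam\<close> of the monomial with tr (U^k).\<close>

lemma lap_mon_eval:
  "\<exists>Q. \<forall>N B U i j. onb_u N B \<longrightarrow> U \<in> carrier_mat N N \<longrightarrow> i < N \<longrightarrow> j < N \<longrightarrow>
     onb_u.lap N B (mon_eval N m i j) U = entry_eval N (D_mon m) i j U - entry_eval N Q i j U / of_nat N ^ 2"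
proof (induction m rule: monomial_induct)
  case (power_u k)
  show ?case
  proof (intro exI allI impI)
    fix N :: nat and B and U :: "complex mat" and i j assume "onb_u N B" and a: "U \<in> carrier_mat N N" "i < N" "j < N"
    then interpret onb_u N B by simp
    show "lap (mon_eval N (Poly_Mapping.single 0 k) i j) U
      = entry_eval N (D_mon (Poly_Mapping.single 0 k)) i j U - entry_eval N 0 i j U / of_nat N ^ 2"
      using lap_pow_entry[OF a, of k]
      unfolding D_mon_power_u entry_eval_D_u entry_eval_zero by (simp add: mon_eval_power_u[abs_def])
  qed
next
  case (times_v m k)
  then obtain Q where Q: "\<And>N B U i j. onb_u N B \<Longrightarrow> U \<in> carrier_mat N N \<Longrightarrow> i < N \<Longrightarrow> j < N \<Longrightarrow>
     onb_u.lap N B (mon_eval N m i j) U = entry_eval N (D_mon m) i j U - entry_eval N Q i j U / of_nat N ^ 2"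
    by blast
  obtain R where R: "\<And>N B U i j. onb_u N B \<Longrightarrow> U \<in> carrier_mat N N \<Longrightarrow> i < N \<Longrightarrow> j < N \<Longrightarrow>
     onb_u.gam N B (mon_eval N m i j) (\<lambda>V. ntr N (V ^\<^sub>m k)) U = - entry_eval N R i j U / of_nat N ^ 2"
    using gam_mon_eval_ntr[of m k] by blast
  show ?case
  proof (intro exI allI impI)
    fix N :: nat and B and U :: "complex mat" and i j assume loc: "onb_u N B" and a: "U \<in> carrier_mat N N" "i < N" "j < N"
    then interpret onb_u N B by simp
    let ?t = "\<lambda>V. ntr N (V ^\<^sub>m k)"
    have "D_mon (m + Poly_Mapping.single k 1) = D_mon m * var_v k + mon m * D_v k"
      using D_mon_mult[of "Poly_Mapping.single k 1" m] D_mon_var_v[OF times_v(2)] times_v(2)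
      by (simp add: lookup_single var_v_def)
    then have D: "entry_eval N (D_mon (m + Poly_Mapping.single k 1)) i j U
        = entry_eval N (D_mon m) i j U * ?t U + mon_eval N m i j U * lap ?t U"
      using times_v(2)
      by (simp add: entry_eval_add entry_eval_times_v entry_eval_times_D_v entry_eval_mon lap_ntr_pow[OF a(1)])
    have "lap (mon_eval N (m + Poly_Mapping.single k 1) i j) U
        = lap (\<lambda>V. mon_eval N m i j V * ?t V) U"
      unfolding mon_eval_times_v[OF times_v(2), abs_def] by (rule refl)
    also have "\<dots> = lap (mon_eval N m i j) U * ?t U + mon_eval N m i j U * lap ?t U + 2 * gam (mon_eval N m i j) ?t U"
      using a by (intro lap_mult twice_lderiv_mon_eval twice_lderiv_ntr_pow)
    also have "\<dots> = entry_eval N (D_mon (m + Poly_Mapping.single k 1)) i j U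
        - entry_eval N (Q * var_v k + 2 * R) i j U / of_nat N ^ 2"
      unfolding Q[OF loc a] R[OF loc a] D using times_v(2)
      by (simp add: entry_eval_add entry_eval_times_v entry_eval_numeral add_divide_distrib left_diff_distrib)
    finally show "lap (mon_eval N (m + Poly_Mapping.single k 1) i j) U = \<dots>" .
  qed
qed

section \<open>Linear extension from monomials to polynomials\<close>

lemma entry_eval_lin_ext:
  "entry_eval N (lin_ext F p) i j U = (\<Sum>m\<in>Poly_Mapping.keys p. Poly_Mapping.lookup p m * entry_eval N (F m) i j U)"
  by (simp add: lin_ext_def entry_eval_sum entry_eval_csmult)

theorem mainTheorem10:
  shows "\<exists>D L :: cpoly \<Rightarrow> cpoly.
     is_linear_op D \<and> is_linear_op L
   \<and> (\<forall>N::nat. N \<ge> 1 \<longrightarrow> (\<forall>p B U. orthonormal_basis_u N B \<longrightarrow> unitary_mat N U \<longrightarrow>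
          laplacian_N N B (eval_N N p) U
            = eval_N N (D p - csmult (1 / of_nat (N ^ 2)) (L p)) U))
   \<and> D_conditions D
   \<and> (\<forall>D'. is_linear_op D' \<and> D_conditions D' \<longrightarrow> D' = D)"
proof -
  \<comment> \<open>One correction is chosen for each monomial, uniformly in N;
    \<open>lin_ext Q\<close> is the operator L.\<close>
  obtain Q where Q: "\<And>m N B U i j. onb_u N B \<Longrightarrow> U \<in> carrier_mat N N \<Longrightarrow> i < N \<Longrightarrow> j < N \<Longrightarrow>
     onb_u.lap N B (mon_eval N m i j) U
      = entry_eval N (D_mon m) i j U - entry_eval N (Q m) i j U / of_nat N ^ 2"
    using lap_mon_eval by metis
  have "laplacian_N N B (eval_N N p) U
      = eval_N N (lin_ext D_mon p - csmult (1 / of_nat (N ^ 2)) (lin_ext Q p)) U"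
    if B: "orthonormal_basis_u N B" and U': "unitary_mat N U" for N p B U
  proof -
    have loc: "onb_u N B" using B by (simp add: onb_u_def)
    then interpret onb_u N B .
    have U: "U \<in> carrier_mat N N" using U' by (simp add: unitary_mat_def)
    have "lap (\<lambda>V. eval_N N p V $$ (i, j)) U
        = entry_eval N (lin_ext D_mon p - csmult (1 / of_nat (N ^ 2)) (lin_ext Q p)) i j U"
      if ij: "i < N" "j < N" for i j
    proof -
      have "lap (\<lambda>V. eval_N N p V $$ (i, j)) U
          = lap (\<lambda>V. \<Sum>m\<in>Poly_Mapping.keys p. Poly_Mapping.lookup p m * mon_eval N m i j V) U"
        using ij by (simp add: eval_N_entry entry_eval_def)
      also have "\<dots> = (\<Sum>m\<in>Poly_Mapping.keys p. lap (\<lambda>V. Poly_Mapping.lookup p m * mon_eval N m i j V) U)"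
        using ij U by (intro lap_sum twice_lderiv_mult twice_lderiv_const twice_lderiv_mon_eval)
      also have "\<dots> = (\<Sum>m\<in>Poly_Mapping.keys p. Poly_Mapping.lookup p m * lap (mon_eval N m i j) U)"
        using ij U by (intro sum.cong refl lap_cmult twice_lderiv_mon_eval)
      finally show ?thesis
        unfolding Q[OF loc U ij]
        by (simp add: entry_eval_diff entry_eval_csmult entry_eval_lin_ext right_diff_distrib
            sum_subtractf sum_divide_distrib)
    qed
    then show ?thesis
      by (auto simp: laplacian_N_def lap_def eval_N_entry[of _ "_ - _"] intro!: eq_matI)
  qed
  then show ?thesis
    using lin_ext_linear D_ext_conditions D_conditions_unique by blast
qed

end
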